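(* There is an algorithm which, given a homogeneous relation $H$ on a finite set $X$ and any subset $S\subseteq X$, computes in $O(|X|^2\log|X|)$ time the partition $MU(S)$, i.e. the coarsest partition of $X$ into umodules of $H$ that is thinner than $\{S,X\setminus S\}$.
   Context: Let $X$ be a finite set. A reflectless triple is $(x|yz)$ with $x,y,z\in X$, $x\neq y$, $x\neq z$. A homogeneous relation $H$ on $X$ is a boolean relation on reflectless triples such that for every $x\in X$ the binary relation $H_x$ on $X\setminus\{x\}$ given by $H_x(y,z)\Leftrightarrow H(x|yz)$ is an equivalence relation. The input $H$ is given by listing, for each $x\in X$, the partition of $X\setminus\{x\}$ into the equivalence classes of $H_x$. A subset $U\subseteq X$ is a umodule of $H$ if for all $u,u'\in U$ and all $x,x'\in X\setminus U$: $H(u|xx')\Leftrightarrow H(u'|xx')$. A partition $\mathcal{Q}$ of $X$ is thinner than a partition $\mathcal{P}$ (and $\mathcal{P}$ is coarser than $\mathcal{Q}$) if every part of $\mathcal{Q}$ is contained in some part of $\mathcal{P}$. For $S\subseteq X$, the inclusion-maximal umodules of $H$ contained in $S$ or in $X\setminus S$ form a partition of $X$, denoted $MU(S)$; it is the coarsest partition of $X$ into umodules which is thinner than $\{S,X\setminus S\}$. *)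

theory Defs
  imports Complex_Main "HOL-Library.Landau_Symbols" "HOL-Library.Disjoint_Sets"
begin

section \<open>Homogeneous relations and umodules\<close>

text \<open>
  A relation on the reflectless triples of \<open>X\<close> is given by a function of type
  \<open>'a \<Rightarrow> 'a \<Rightarrow> 'a \<Rightarrow> bool\<close>, where \<open>H x y z\<close> stands for \<open>H(x|yz)\<close>.  Only the values with
  \<open>x, y, z \<in> X\<close>, \<open>x \<noteq> y\<close> and \<open>x \<noteq> z\<close> play a role; all definitions ignore the others.
\<close>

definition rel_at :: "'a set \<Rightarrow> ('a \<Rightarrow> 'a \<Rightarrow> 'a \<Rightarrow> bool) \<Rightarrow> 'a \<Rightarrow> ('a \<times> 'a) set" where
  "rel_at X H x = {(y, z). y \<in> X - {x} \<and> z \<in> X - {x} \<and> H x y z}"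

definition homogeneous :: "'a set \<Rightarrow> ('a \<Rightarrow> 'a \<Rightarrow> 'a \<Rightarrow> bool) \<Rightarrow> bool" where
  "homogeneous X H \<longleftrightarrow> (\<forall>x\<in>X. equiv (X - {x}) (rel_at X H x))"

definition umodule :: "'a set \<Rightarrow> ('a \<Rightarrow> 'a \<Rightarrow> 'a \<Rightarrow> bool) \<Rightarrow> 'a set \<Rightarrow> bool" where
  "umodule X H U \<longleftrightarrow> U \<subseteq> X \<and>
     (\<forall>u\<in>U. \<forall>u'\<in>U. \<forall>x\<in>X - U. \<forall>x'\<in>X - U. H u x x' \<longleftrightarrow> H u' x x')"

text \<open>
  The library's \<open>refines\<close> is not used here, because it requires both arguments to be partitions
  into nonempty parts, which \<open>{S, X - S}\<close> is not if \<open>S = {}\<close> or \<open>S = X\<close>.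
\<close>

definition thinner :: "'a set set \<Rightarrow> 'a set set \<Rightarrow> bool" where
  "thinner Q P \<longleftrightarrow> (\<forall>A\<in>Q. \<exists>B\<in>P. A \<subseteq> B)"

definition umodule_in_side ::
    "'a set \<Rightarrow> ('a \<Rightarrow> 'a \<Rightarrow> 'a \<Rightarrow> bool) \<Rightarrow> 'a set \<Rightarrow> 'a set \<Rightarrow> bool" where
  "umodule_in_side X H S U \<longleftrightarrow> umodule X H U \<and> (U \<subseteq> S \<or> U \<subseteq> X - S)"

text \<open>The condition \<open>U \<noteq> {}\<close> only matters for \<open>X = {}\<close>, where it makes \<open>MU\<close> the empty partition.\<close>

definition MU :: "'a set \<Rightarrow> ('a \<Rightarrow> 'a \<Rightarrow> 'a \<Rightarrow> bool) \<Rightarrow> 'a set \<Rightarrow> 'a set set" where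
  "MU X H S = {U. U \<noteq> {} \<and> umodule_in_side X H S U \<and>
                  (\<forall>V. umodule_in_side X H S V \<and> U \<subseteq> V \<longrightarrow> V = U)}"

definition umodule_partition ::
    "'a set \<Rightarrow> ('a \<Rightarrow> 'a \<Rightarrow> 'a \<Rightarrow> bool) \<Rightarrow> 'a set \<Rightarrow> 'a set set \<Rightarrow> bool" where
  "umodule_partition X H S P \<longleftrightarrow>
     partition_on X P \<and> (\<forall>U\<in>P. umodule X H U) \<and> thinner P {S, X - S}"

definition coarsest_umodule_partition ::
    "'a set \<Rightarrow> ('a \<Rightarrow> 'a \<Rightarrow> 'a \<Rightarrow> bool) \<Rightarrow> 'a set \<Rightarrow> 'a set set \<Rightarrow> bool" where
  "coarsest_umodule_partition X H S P \<longleftrightarrow>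
     umodule_partition X H S P \<and> (\<forall>Q. umodule_partition X H S Q \<longrightarrow> thinner Q P)"


section \<open>A word RAM\<close>

text \<open>
  Programs are while programs over a fixed finite set of word variables and random access arrays
  (those occurring in the program text).  The machine has words of \<open>w\<close> bits: a run exists only if
  every word it computes, every constant it uses and every address it accesses is below \<open>2 ^ w\<close>.
  One step is charged for every node of an evaluated expression and for every executed command.
\<close>

datatype aexp =
    Const nat
  | Var string
  | Read string aexp
  | Plus aexp aexp
  | Minus aexp aexp
  | Times aexp aexp

datatype bexp =
    Less aexp aexp
  | Equal aexp aexp
  | Neg bexp
  | Conj bexp bexp

datatype com =
    Skip
  | Assign string aexp
  | Write string aexp aexp
  | Seq com com
  | Cond bexp com com
  | While bexp com

record state =
  vars :: "string \<Rightarrow> nat"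
  arrays :: "string \<Rightarrow> nat \<Rightarrow> nat"

fun aval :: "aexp \<Rightarrow> state \<Rightarrow> nat" where
  "aval (Const k) s = k"
| "aval (Var x) s = vars s x"
| "aval (Read a e) s = arrays s a (aval e s)"
| "aval (Plus e f) s = aval e s + aval f s"
| "aval (Minus e f) s = aval e s - aval f s"
| "aval (Times e f) s = aval e s * aval f s"

fun bval :: "bexp \<Rightarrow> state \<Rightarrow> bool" where
  "bval (Less e f) s = (aval e s < aval f s)"
| "bval (Equal e f) s = (aval e s = aval f s)"
| "bval (Neg b) s = (\<not> bval b s)"
| "bval (Conj b c) s = (bval b s \<and> bval c s)"

fun asubexps :: "aexp \<Rightarrow> aexp set" where
  "asubexps (Const k) = {Const k}"
| "asubexps (Var x) = {Var x}"
| "asubexps (Read a e) = insert (Read a e) (asubexps e)"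
| "asubexps (Plus e f) = insert (Plus e f) (asubexps e \<union> asubexps f)"
| "asubexps (Minus e f) = insert (Minus e f) (asubexps e \<union> asubexps f)"
| "asubexps (Times e f) = insert (Times e f) (asubexps e \<union> asubexps f)"

definition afits :: "nat \<Rightarrow> aexp \<Rightarrow> state \<Rightarrow> bool" where
  "afits w e s \<longleftrightarrow> (\<forall>f\<in>asubexps e. aval f s < 2 ^ w)"

fun bfits :: "nat \<Rightarrow> bexp \<Rightarrow> state \<Rightarrow> bool" where
  "bfits w (Less e f) s = (afits w e s \<and> afits w f s)"
| "bfits w (Equal e f) s = (afits w e s \<and> afits w f s)"
| "bfits w (Neg b) s = bfits w b s"
| "bfits w (Conj b c) s = (bfits w b s \<and> bfits w c s)"

fun acost :: "aexp \<Rightarrow> nat" where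
  "acost (Const k) = 1"
| "acost (Var x) = 1"
| "acost (Read a e) = 1 + acost e"
| "acost (Plus e f) = 1 + acost e + acost f"
| "acost (Minus e f) = 1 + acost e + acost f"
| "acost (Times e f) = 1 + acost e + acost f"

fun bcost :: "bexp \<Rightarrow> nat" where
  "bcost (Less e f) = 1 + acost e + acost f"
| "bcost (Equal e f) = 1 + acost e + acost f"
| "bcost (Neg b) = 1 + bcost b"
| "bcost (Conj b c) = 1 + bcost b + bcost c"

text \<open>
  \<open>runs w c s k t\<close>: on the machine with word size \<open>w\<close>, the command \<open>c\<close> started in state \<open>s\<close>
  terminates in state \<open>t\<close> after exactly \<open>k\<close> steps.
\<close>

inductive runs :: "nat \<Rightarrow> com \<Rightarrow> state \<Rightarrow> nat \<Rightarrow> state \<Rightarrow> bool" for w where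
  runs_Skip: "runs w Skip s 1 s"
| runs_Assign: "afits w e s \<Longrightarrow>
    runs w (Assign x e) s (1 + acost e) (s\<lparr>vars := (vars s)(x := aval e s)\<rparr>)"
| runs_Write: "afits w e s \<Longrightarrow> afits w f s \<Longrightarrow>
    runs w (Write a e f) s (1 + acost e + acost f)
      (s\<lparr>arrays := (arrays s)(a := (arrays s a)(aval e s := aval f s))\<rparr>)"
| runs_Seq: "runs w c s k t \<Longrightarrow> runs w d t l u \<Longrightarrow> runs w (Seq c d) s (1 + k + l) u"
| runs_CondTrue: "bfits w b s \<Longrightarrow> bval b s \<Longrightarrow> runs w c s k t \<Longrightarrow>
    runs w (Cond b c d) s (1 + bcost b + k) t"
| runs_CondFalse: "bfits w b s \<Longrightarrow> \<not> bval b s \<Longrightarrow> runs w d s k t \<Longrightarrow>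
    runs w (Cond b c d) s (1 + bcost b + k) t"
| runs_WhileFalse: "bfits w b s \<Longrightarrow> \<not> bval b s \<Longrightarrow>
    runs w (While b c) s (1 + bcost b) s"
| runs_WhileTrue: "bfits w b s \<Longrightarrow> bval b s \<Longrightarrow> runs w c s k t \<Longrightarrow>
    runs w (While b c) t l u \<Longrightarrow> runs w (While b c) s (1 + bcost b + k + l) u"

text \<open>
  The input words are stored in the array \<open>''in''\<close> from address \<open>0\<close> on; everything else is \<open>0\<close>
  initially.  The output is read off from the array \<open>''out''\<close>, again from address \<open>0\<close> on.
\<close>

definition init_state :: "nat list \<Rightarrow> state" where
  "init_state ws = \<lparr>vars = (\<lambda>_. 0),
     arrays = (\<lambda>a i. if a = ''in'' \<and> i < length ws then ws ! i else 0)\<rparr>"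

definition has_output :: "state \<Rightarrow> nat list \<Rightarrow> bool" where
  "has_output t ws \<longleftrightarrow> (\<forall>i<length ws. arrays t ''out'' i = ws ! i)"


section \<open>Representation of inputs and outputs\<close>

text \<open>
  The elements of \<open>X\<close> are numbered by an enumeration \<open>xs\<close> of \<open>X\<close>: a number \<open>i < length xs\<close>
  represents the element \<open>xs ! i\<close>.  Sets and partitions are represented by listing the numbers of
  their elements, without repetition and in arbitrary order.
\<close>

definition lists_set :: "'a list \<Rightarrow> 'a set \<Rightarrow> nat list \<Rightarrow> bool" where
  "lists_set xs A l \<longleftrightarrow> distinct l \<and> set l \<subseteq> {..<length xs} \<and> (\<lambda>i. xs ! i) ` set l = A"

definition lists_partition :: "'a list \<Rightarrow> 'a set set \<Rightarrow> nat list list \<Rightarrow> bool" where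
  "lists_partition xs P ls \<longleftrightarrow> distinct (concat ls) \<and> [] \<notin> set ls \<and>
     set (concat ls) \<subseteq> {..<length xs} \<and> (\<lambda>l. (\<lambda>i. xs ! i) ` set l) ` set ls = P"

definition enc_set :: "nat list \<Rightarrow> nat list" where
  "enc_set l = length l # l"

definition enc_partition :: "nat list list \<Rightarrow> nat list" where
  "enc_partition ls = length ls # concat (map enc_set ls)"

definition enc_input :: "nat list list list \<Rightarrow> nat list \<Rightarrow> nat list" where
  "enc_input hs l = length hs # concat (map enc_partition hs) @ enc_set l"

text \<open>
  The list \<open>hs\<close> contains, for each element \<open>x\<close> of \<open>X\<close> in the order of the enumeration, a listing
  of the partition of \<open>X - {x}\<close> into the equivalence classes of \<open>H\<close> at \<open>x\<close>.
\<close>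

definition represents_input ::
    "'a set \<Rightarrow> ('a \<Rightarrow> 'a \<Rightarrow> 'a \<Rightarrow> bool) \<Rightarrow> 'a set \<Rightarrow> 'a list \<Rightarrow> nat list \<Rightarrow> bool" where
  "represents_input X H S xs ws \<longleftrightarrow> distinct xs \<and> set xs = X \<and>
     (\<exists>hs l. ws = enc_input hs l \<and> length hs = length xs \<and>
        (\<forall>i<length xs.
           lists_partition xs ((X - {xs ! i}) // rel_at X H (xs ! i)) (hs ! i)) \<and>
        lists_set xs S l)"

definition represents_output :: "'a list \<Rightarrow> 'a set set \<Rightarrow> state \<Rightarrow> bool" where
  "represents_output xs P t \<longleftrightarrow>
     (\<exists>ls. lists_partition xs P ls \<and> has_output t (enc_partition ls))"

end

theory Submission
  imports Defs "HOL-Real_Asymp.Real_Asymp"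
begin

text \<open>
  The algorithm refines the partition \<open>{S, X - S}\<close>.  It compares a part \<open>C\<close> with an element \<open>y\<close>
  outside \<open>C\<close>: every \<open>u \<in> C\<close> labels \<open>y\<close> with the first element of the class of \<open>y\<close> under \<open>H\<^sub>u\<close>
  that has been compared with the part of \<open>u\<close>, and \<open>C\<close> is split if the labels differ.  The elements
  of a umodule \<open>V\<close> agree on the classes outside \<open>V\<close>, hence on all labels given outside \<open>V\<close>, so no
  split cuts a umodule contained in \<open>S\<close> or in \<open>X - S\<close>.  Once all comparisons with outside elements
  give constant labels, two outside elements are equivalent for some \<open>u \<in> C\<close> iff their labels are
  equal, which does not depend on \<open>u\<close>; so the parts are umodules, and the partition is \<open>MU S\<close>.

  A comparison takes \<open>O(|C|)\<close> steps.  If it does not split \<open>C\<close>, it settles the \<open>|C|\<close> pairs \<open>(u, y)\<close>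
  with \<open>u \<in> C\<close> for good, because a split later on leaves the labels equal on both halves.  A split
  costs \<open>O(n)\<close> and happens less than \<open>n\<close> times.  The total is \<open>O(n\<^sup>2)\<close>.
\<close>

text \<open>The classes at different elements are numbered independently, so class numbers at
  \<open>u\<close> and \<open>u'\<close> cannot be compared. Naming a class by one of its elements
  gives names with a common meaning. Not every element will do: a name taken inside a umodule
  \<open>V\<close> could differ between the members of \<open>V\<close>. An element that has been
  compared with a part lies outside it, hence outside every umodule inside it, and all members of a
  part share the same history of comparisons; so the first compared element is a name on which the
  members of \<open>V\<close> must agree. The settled state is stored per part and not per pair: one
  flag stands for \<open>|C|\<close> pairs, and a split only has to copy a row of flags. The
  resulting bound is quadratic, so the logarithmic factor of the claim is slack.\<close>

section \<open>Weakest preconditions with time credits\<close>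

text \<open>\<open>N\<close> is a supply of credits, one per step; the postcondition receives what is left of it.\<close>

definition wpt :: "nat \<Rightarrow> com \<Rightarrow> (state \<Rightarrow> nat \<Rightarrow> bool) \<Rightarrow> state \<Rightarrow> nat \<Rightarrow> bool" where
  "wpt w c Q s N \<longleftrightarrow> (\<exists>k t. runs w c s k t \<and> k \<le> N \<and> Q t (N - k))"

lemma wpt_mono: "wpt w c Q s N \<Longrightarrow> (\<And>t M. Q t M \<Longrightarrow> R t M) \<Longrightarrow> wpt w c R s N"
  unfolding wpt_def by blast

lemma wpt_Skip [simp]: "wpt w Skip Q s N \<longleftrightarrow> 1 \<le> N \<and> Q s (N - 1)"
  unfolding wpt_def by (force intro: runs_Skip elim: runs.cases)

lemma wpt_Assign [simp]:
  "wpt w (Assign x e) Q s N \<longleftrightarrow>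
     afits w e s \<and> 1 + acost e \<le> N \<and>
     Q (s\<lparr>vars := (vars s)(x := aval e s)\<rparr>) (N - (1 + acost e))"
  (is "?L \<longleftrightarrow> ?R")
proof
  show "?L \<Longrightarrow> ?R" unfolding wpt_def by (auto elim: runs.cases)
  show "?R \<Longrightarrow> ?L" unfolding wpt_def using runs_Assign[of w e s x] by blast
qed

lemma wpt_Write [simp]:
  "wpt w (Write a e f) Q s N \<longleftrightarrow>
     afits w e s \<and> afits w f s \<and> 1 + acost e + acost f \<le> N \<and>
     Q (s\<lparr>arrays := (arrays s)(a := (arrays s a)(aval e s := aval f s))\<rparr>)
       (N - (1 + acost e + acost f))"
  (is "?L \<longleftrightarrow> ?R")
proof
  show "?L \<Longrightarrow> ?R" unfolding wpt_def by (auto elim: runs.cases)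
  show "?R \<Longrightarrow> ?L" unfolding wpt_def using runs_Write[of w e s f a] by blast
qed

lemma wpt_Seq [simp]:
  "wpt w (Seq c d) Q s N \<longleftrightarrow> 1 \<le> N \<and> wpt w c (wpt w d Q) s (N - 1)" (is "?L \<longleftrightarrow> ?R")
proof
  assume ?L
  then obtain k t where "runs w (Seq c d) s k t" "k \<le> N" "Q t (N - k)"
    unfolding wpt_def by blast
  then show ?R
  proof cases
    case (runs_Seq k1 t1 l)
    then have "wpt w d Q t1 (N - 1 - k1)"
      unfolding wpt_def using \<open>k \<le> N\<close> \<open>Q t (N - k)\<close>
      by (intro exI[of _ l] exI[of _ t]) auto
    moreover have "1 \<le> N" "k1 \<le> N - 1"
      using runs_Seq \<open>k \<le> N\<close> by auto
    ultimately show ?thesis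
      using runs_Seq(2) unfolding wpt_def[of w c] by blast
  qed
next
  assume ?R
  then obtain k t l u where "1 \<le> N" "runs w c s k t" "k \<le> N - 1" "runs w d t l u"
    "l \<le> N - 1 - k" "Q u (N - 1 - k - l)"
    unfolding wpt_def by blast
  then show ?L
    unfolding wpt_def
    by (intro exI[of _ "1 + k + l"] exI[of _ u]) (use runs_Seq[of w c s k t d l u] in auto)
qed

lemma wpt_Cond [simp]:
  "wpt w (Cond b c d) Q s N \<longleftrightarrow>
     bfits w b s \<and> 1 + bcost b \<le> N \<and>
     (if bval b s then wpt w c Q s (N - (1 + bcost b)) else wpt w d Q s (N - (1 + bcost b)))"
  (is "?L \<longleftrightarrow> ?R")
proof
  assume ?L
  then obtain k t where "runs w (Cond b c d) s k t" "k \<le> N" "Q t (N - k)"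
    unfolding wpt_def by blast
  then show ?R
  proof cases
    case (runs_CondTrue l)
    then have "l \<le> N - (1 + bcost b)" "Q t (N - (1 + bcost b) - l)"
      using \<open>k \<le> N\<close> \<open>Q t (N - k)\<close> by auto
    then have "wpt w c Q s (N - (1 + bcost b))"
      unfolding wpt_def using runs_CondTrue by blast
    with runs_CondTrue \<open>k \<le> N\<close> show ?thesis by simp
  next
    case (runs_CondFalse l)
    then have "l \<le> N - (1 + bcost b)" "Q t (N - (1 + bcost b) - l)"
      using \<open>k \<le> N\<close> \<open>Q t (N - k)\<close> by auto
    then have "wpt w d Q s (N - (1 + bcost b))"
      unfolding wpt_def using runs_CondFalse by blast
    with runs_CondFalse \<open>k \<le> N\<close> show ?thesis by simp
  qed
next
  assume R: ?R
  show ?L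
  proof (cases "bval b s")
    case True
    with R obtain k t where "runs w c s k t" "k \<le> N - (1 + bcost b)"
      "Q t (N - (1 + bcost b) - k)"
      unfolding wpt_def by auto
    with R True show ?thesis
      unfolding wpt_def
      by (intro exI[of _ "1 + bcost b + k"] exI[of _ t]) (use runs_CondTrue[of w b s c k t d] in auto)
  next
    case False
    with R obtain k t where "runs w d s k t" "k \<le> N - (1 + bcost b)"
      "Q t (N - (1 + bcost b) - k)"
      unfolding wpt_def by auto
    with R False show ?thesis
      unfolding wpt_def
      by (intro exI[of _ "1 + bcost b + k"] exI[of _ t]) (use runs_CondFalse[of w b s d k t c] in auto)
  qed
qed

text \<open>Every iteration consumes credits, so termination needs no separate argument.\<close>

lemma wpt_While:
  assumes "I s N"
    and step: "\<And>s N. I s N \<Longrightarrow> bfits w b s \<and> 1 + bcost b \<le> N \<and>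
      (if bval b s then wpt w c I s (N - (1 + bcost b)) else Q s (N - (1 + bcost b)))"
  shows "wpt w (While b c) Q s N"
  using assms(1)
proof (induction N arbitrary: s rule: less_induct)
  case (less N)
  note st = step[OF less.prems]
  show ?case
  proof (cases "bval b s")
    case True
    with st obtain k t where kt: "runs w c s k t" "k \<le> N - (1 + bcost b)"
      "I t (N - (1 + bcost b) - k)"
      unfolding wpt_def by auto
    moreover have "N - (1 + bcost b) - k < N"
      using st by auto
    ultimately have "wpt w (While b c) Q t (N - (1 + bcost b) - k)"
      using less.IH by blast
    then obtain l u where "runs w (While b c) t l u" "l \<le> N - (1 + bcost b) - k"
      "Q u (N - (1 + bcost b) - k - l)"
      unfolding wpt_def by blast
    with st True kt show ?thesis
      unfolding wpt_def
      by (intro exI[of _ "1 + bcost b + k + l"] exI[of _ u]) (use runs_WhileTrue[of w b s c k t l u] in auto)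
  next
    case False
    with st show ?thesis
      unfolding wpt_def
      by (intro exI[of _ "1 + bcost b"] exI[of _ s]) (use runs_WhileFalse[of w b s c] in auto)
  qed
qed

fun block :: "com list \<Rightarrow> com" where
  "block [] = Skip"
| "block (c # cs) = Seq c (block cs)"


section \<open>The refinement algorithm\<close>

abbreviation index :: "string \<Rightarrow> aexp \<Rightarrow> aexp" where
  "index x e \<equiv> Plus (Times (Var x) (Var ''n'')) e"

abbreviation incr :: "string \<Rightarrow> com" where
  "incr x \<equiv> Assign x (Plus (Var x) (Const 1))"

abbreviation at_input :: aexp where
  "at_input \<equiv> Read ''in'' (Var ''t'')"

text \<open>\<open>cls\<close> is an \<open>n\<close> by \<open>n\<close> matrix stored row by row;
  its entries are the positions of the classes in the listing at \<open>i\<close>. The listing at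
  \<open>i\<close> omits \<open>i\<close> itself, so the diagonal keeps its initial value 0.\<close>

definition parse_class :: com where
  "parse_class = While (Less (Var ''j'') (Var ''r'')) (block
     [Write ''cls'' (index ''i'' at_input) (Var ''k''), incr ''t'', incr ''j''])"

definition parse_partition :: com where
  "parse_partition = While (Less (Var ''k'') (Var ''q'')) (block
     [Assign ''r'' at_input, incr ''t'', Assign ''j'' (Const 0), parse_class, incr ''k''])"

definition parse_relation :: com where
  "parse_relation = While (Less (Var ''i'') (Var ''n'')) (block
     [Assign ''q'' at_input, incr ''t'', Assign ''k'' (Const 0), parse_partition, incr ''i''])"

definition parse_subset :: com where
  "parse_subset = While (Less (Var ''j'') (Var ''r'')) (block
     [Write ''side'' at_input (Const 1), incr ''t'', incr ''j''])"

text \<open>With truncated subtraction, \<open>1 - (1 - e)\<close> is \<open>0\<close> if \<open>e = 0\<close> and \<open>1\<close> otherwise.\<close>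

abbreviation positive :: "aexp \<Rightarrow> aexp" where
  "positive e \<equiv> Minus (Const 1) (Minus (Const 1) e)"

text \<open>The factor \<open>positive r\<close> sends everything to part 0 if \<open>S\<close> is
  empty. Thus a single nonempty side always gets number 0 and no part number below \<open>m\<close>
  is left without elements.\<close>

definition init_parts :: com where
  "init_parts = While (Less (Var ''u'') (Var ''n'')) (block
     [Assign ''c'' (Times (Minus (Const 1) (Read ''side'' (Var ''u''))) (positive (Var ''r''))),
      Write ''part'' (Var ''u'') (Var ''c''),
      Write ''mem'' (index ''c'' (Read ''size'' (Var ''c''))) (Var ''u''),
      Write ''size'' (Var ''c'') (Plus (Read ''size'' (Var ''c'')) (Const 1)),
      incr ''u''])"

abbreviation locate_label :: com where
  "locate_label \<equiv> Assign ''a'' (index ''u'' (Read ''cls'' (index ''u'' (Var ''y''))))"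

text \<open>Row \<open>c\<close> of \<open>mem\<close> is compacted in place, and the elements that
  leave are collected in the fresh row \<open>m\<close>. The entry \<open>size c\<close> bounds the
  loop and is therefore corrected only afterwards.\<close>

definition separate :: com where
  "separate = While (Less (Var ''i'') (Read ''size'' (Var ''c''))) (block
     [Assign ''u'' (Read ''mem'' (index ''c'' (Var ''i''))),
      locate_label,
      Cond (Equal (Read ''rep'' (Var ''a'')) (Const 0))
        (Write ''rep'' (Var ''a'') (Plus (Var ''y'') (Const 1))) Skip,
      Cond (Equal (Read ''rep'' (Var ''a'')) (Var ''l''))
        (block [Write ''mem'' (index ''c'' (Var ''j'')) (Var ''u''), incr ''j''])
        (block [Write ''mem'' (index ''m'' (Var ''h'')) (Var ''u''), incr ''h'',
                Write ''part'' (Var ''u'') (Var ''m'')]),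
      incr ''i''])"

text \<open>Labels that are constant on a part are constant on each of its subsets, so the new part
  inherits the flags of the part from which it was cut.\<close>

definition copy_done :: com where
  "copy_done = While (Less (Var ''x'') (Var ''n'')) (block
     [Write ''done'' (index ''m'' (Var ''x'')) (Read ''done'' (index ''c'' (Var ''x''))),
      incr ''x''])"

text \<open>The reference label \<open>l\<close> is the one that the first member will have once its
  slot has been filled, so the first member always stays in \<open>c\<close>. After a split
  \<open>y\<close> returns to 0, because the elements that have just left \<open>c\<close> are now
  outside it and the scan may already have passed them.\<close>

definition process :: com where
  "process = block
     [Assign ''u'' (Read ''mem'' (index ''c'' (Const 0))),
      locate_label,
      Assign ''l'' (Read ''rep'' (Var ''a'')),
      Cond (Equal (Var ''l'') (Const 0)) (Assign ''l'' (Plus (Var ''y'') (Const 1))) Skip,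
      Assign ''i'' (Const 0), Assign ''j'' (Const 0), Assign ''h'' (Const 0),
      separate,
      Cond (Equal (Var ''h'') (Const 0))
        (block [Write ''done'' (index ''c'' (Var ''y'')) (Const 1), incr ''y''])
        (block [Write ''size'' (Var ''c'') (Var ''j''), Write ''size'' (Var ''m'') (Var ''h''),
                Assign ''x'' (Const 0), copy_done, incr ''m'', Assign ''y'' (Const 0)])]"

text \<open>One pass over the part numbers suffices. Only the current part \<open>c\<close> is ever
  split and the new part is numbered \<open>m > c\<close>, so no element enters or leaves a part
  below \<open>c\<close>, and its comparisons stay complete.\<close>

definition refine :: com where
  "refine = While (Less (Var ''c'') (Var ''m''))
     (Cond (Less (Var ''y'') (Var ''n''))
        (Cond (Conj (Neg (Equal (Read ''part'' (Var ''y'')) (Var ''c'')))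
                    (Equal (Read ''done'' (index ''c'' (Var ''y''))) (Const 0)))
          process
          (incr ''y''))
        (block [incr ''c'', Assign ''y'' (Const 0)]))"

definition write_part :: com where
  "write_part = While (Less (Var ''i'') (Read ''size'' (Var ''c''))) (block
     [Write ''out'' (Var ''t'') (Read ''mem'' (index ''c'' (Var ''i''))), incr ''t'', incr ''i''])"

definition write_parts :: com where
  "write_parts = While (Less (Var ''c'') (Var ''m'')) (block
     [Write ''out'' (Var ''t'') (Read ''size'' (Var ''c'')), incr ''t'',
      Assign ''i'' (Const 0), write_part, incr ''c''])"

definition compute_MU :: com where
  "compute_MU = block
     [Assign ''n'' at_input, incr ''t'', Assign ''i'' (Const 0), parse_relation,
      Assign ''r'' at_input, incr ''t'', Assign ''j'' (Const 0), parse_subset,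
      Assign ''u'' (Const 0), init_parts,
      Assign ''m'' (Plus (positive (Var ''r'')) (positive (Minus (Var ''n'') (Var ''r'')))),
      Assign ''c'' (Const 0), Assign ''y'' (Const 0), refine,
      Write ''out'' (Const 0) (Var ''m''),
      Assign ''t'' (Const 1), Assign ''c'' (Const 0), write_parts]"

section \<open>The invariant\<close>

definition row :: "nat \<Rightarrow> (nat \<Rightarrow> 'b) \<Rightarrow> nat \<Rightarrow> nat \<Rightarrow> 'b list" where
  "row n f c k = map (\<lambda>i. f (c * n + i)) [0..<k]"

lemma length_row [simp]: "length (row n f c k) = k"
  by (simp add: row_def)

lemma nth_row [simp]: "i < k \<Longrightarrow> row n f c k ! i = f (c * n + i)"
  by (simp add: row_def)

lemma row_0 [simp]: "row n f c 0 = []"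
  by (simp add: row_def)

lemma row_Suc: "row n f c (Suc k) = row n f c k @ [f (c * n + k)]"
  by (simp add: row_def)

lemma row_cong: "(\<And>i. i < k \<Longrightarrow> f (c * n + i) = g (c * n + i)) \<Longrightarrow> row n f c k = row n g c k"
  by (simp add: row_def)

lemma address_inj [simp]:
  "i < n \<Longrightarrow> j < n \<Longrightarrow> c * n + i = d * n + j \<longleftrightarrow> c = d \<and> i = (j::nat)"
  (is "_ \<Longrightarrow> _ \<Longrightarrow> ?L \<longleftrightarrow> _")
proof
  assume *: "i < n" "j < n" "c * n + i = d * n + j"
  show "c = d \<and> i = j"
    using arg_cong[OF *(3), of "\<lambda>x. x div n"] arg_cong[OF *(3), of "\<lambda>x. x mod n"] *(1,2)
    by (simp add: div_add1_eq mult.commute)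
qed simp

text \<open>This is the parsed input seen abstractly. Homogeneity enters through
  \<open>cls_eq\<close> alone, since equality of class numbers is an equivalence. Diagonal entries
  of \<open>cls\<close> are unconstrained.\<close>

locale umodule_instance =
  fixes X :: "'a set" and H S xs and cls :: "nat \<Rightarrow> nat" and n :: nat
  assumes distinct_xs: "distinct xs" and set_xs: "set xs = X" and n_def: "n = length xs"
    and S_subset: "S \<subseteq> X"
    and cls_less: "\<And>u x. u < n \<Longrightarrow> x < n \<Longrightarrow> x \<noteq> u \<Longrightarrow> cls (u * n + x) < n"
    and cls_eq: "\<And>u x x'. u < n \<Longrightarrow> x < n \<Longrightarrow> x' < n \<Longrightarrow> x \<noteq> u \<Longrightarrow> x' \<noteq> u \<Longrightarrow>
      cls (u * n + x) = cls (u * n + x') \<longleftrightarrow> H (xs ! u) (xs ! x) (xs ! x')"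
begin

abbreviation label :: "(nat \<Rightarrow> nat) \<Rightarrow> nat \<Rightarrow> nat \<Rightarrow> nat" where
  "label rep u x \<equiv> rep (u * n + cls (u * n + x))"

text \<open>
  \<open>rep (u * n + k) = Suc r\<close> means that \<open>r\<close> was the first element of class \<open>k\<close> at \<open>u\<close> that has been
  compared with the part of \<open>u\<close>; \<open>0\<close> stands for no such element.
\<close>

definition parts_inv where
  "parts_inv part m mem sz \<longleftrightarrow>
     (\<forall>u<n. part u < m) \<and>
     (\<forall>c<m. 0 < sz c \<and> distinct (row n mem c (sz c)) \<and>
        set (row n mem c (sz c)) = {u. u < n \<and> part u = c}) \<and>
     (\<forall>u<n. \<forall>u'<n. part u = part u' \<longrightarrow> (xs ! u \<in> S \<longleftrightarrow> xs ! u' \<in> S))"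

text \<open>In the row of a fixed \<open>u\<close>, equal nonzero labels force equal classes,
  because both classes are that of \<open>r\<close>. This lets equality of labels stand for
  equivalence.\<close>

definition rep_inv where
  "rep_inv rep \<longleftrightarrow>
     (\<forall>u<n. \<forall>k<n. \<forall>r. rep (u * n + k) = Suc r \<longrightarrow> r < n \<and> cls (u * n + r) = k)"

text \<open>This protects the umodules: none is cut, and the state cannot tell its members apart
  from outside. Labels at elements inside \<open>V\<close> may differ; labels outside agree also in
  being 0.\<close>

definition coherent where
  "coherent part rep \<longleftrightarrow>
     (\<forall>V. umodule_in_side X H S V \<longrightarrow>
       (\<forall>u<n. \<forall>u'<n. xs ! u \<in> V \<longrightarrow> xs ! u' \<in> V \<longrightarrow> part u = part u' \<and>
          (\<forall>x<n. xs ! x \<notin> V \<longrightarrow> label rep u x = label rep u' x)))"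

text \<open>The label must be nonzero because filled slots are frozen, whereas two empty slots could
  later be filled differently. The bound 1 keeps the flag small enough for a word and turns a
  nonzero flag into 1.\<close>

definition done_inv where
  "done_inv part m rep dn \<longleftrightarrow>
     (\<forall>c<m. \<forall>y<n. dn (c * n + y) \<le> 1 \<and> (dn (c * n + y) = 1 \<longrightarrow> part y \<noteq> c \<and>
        (\<forall>u<n. \<forall>u'<n. part u = c \<longrightarrow> part u' = c \<longrightarrow>
           label rep u y = label rep u' y \<and> label rep u y \<noteq> 0)))"

definition scan_inv where
  "scan_inv part m dn c y \<longleftrightarrow> c \<le> m \<and> y \<le> n \<and>
     (\<forall>d<c. \<forall>z<n. part z \<noteq> d \<longrightarrow> dn (d * n + z) = (1::nat)) \<and>
     (\<forall>z<y. part z \<noteq> c \<longrightarrow> dn (c * n + z) = 1)"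

definition refine_inv where
  "refine_inv part m mem sz rep dn c y \<longleftrightarrow>
     parts_inv part m mem sz \<and> rep_inv rep \<and> coherent part rep \<and>
     done_inv part m rep dn \<and> scan_inv part m dn c y"

lemma refine_invI:
  "parts_inv part m mem sz \<Longrightarrow> rep_inv rep \<Longrightarrow> coherent part rep \<Longrightarrow>
   done_inv part m rep dn \<Longrightarrow> scan_inv part m dn c y \<Longrightarrow> refine_inv part m mem sz rep dn c y"
  unfolding refine_inv_def by blast

section \<open>Bounds on the number and the sizes of the parts\<close>

lemma nth_in_X [simp]: "u < n \<Longrightarrow> xs ! u \<in> X"
  using set_xs n_def by auto

lemma parts_le:
  assumes "parts_inv part m mem sz"
  shows "m \<le> n"
proof -
  have "c \<in> part ` {..<n}" if "c < m" for c
  proof -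
    have "row n mem c (sz c) ! 0 \<in> set (row n mem c (sz c))"
      using assms that unfolding parts_inv_def by (intro nth_mem) simp
    then have "row n mem c (sz c) ! 0 < n" "part (row n mem c (sz c) ! 0) = c"
      using assms that unfolding parts_inv_def by blast+
    then show ?thesis by (metis imageI lessThan_iff)
  qed
  then have "{..<m} \<subseteq> part ` {..<n}" by auto
  then show ?thesis
    using card_mono[of "part ` {..<n}" "{..<m}"] card_image_le[of "{..<n}" part] by auto
qed

lemma size_le:
  assumes "parts_inv part m mem sz" "c < m"
  shows "sz c \<le> n"
proof -
  have "length (row n mem c (sz c)) = card {u. u < n \<and> part u = c}"
    using assms distinct_card unfolding parts_inv_def by metis
  also have "\<dots> \<le> card {..<n}"
    by (rule card_mono) auto
  finally show ?thesis by simp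
qed

section \<open>The representatives after a comparison\<close>

text \<open>The address of the label of \<open>u\<close> for \<open>y\<close> is written only if it still contains \<open>0\<close>.\<close>

definition new_rep :: "(nat \<Rightarrow> nat) \<Rightarrow> nat set \<Rightarrow> nat \<Rightarrow> nat \<Rightarrow> nat" where
  "new_rep rep C y a =
     (if a \<in> (\<lambda>u. u * n + cls (u * n + y)) ` C \<and> rep a = 0 then Suc y else rep a)"

text \<open>As \<open>y\<close> is outside \<open>C\<close>, it differs from each member
  \<open>v\<close>, so \<open>cls (v * n + y) < n\<close> and the slot of \<open>v\<close> lies in
  row \<open>v\<close>. Members therefore cannot overwrite each other's slots.\<close>

lemma new_rep_in:
  assumes "C \<subseteq> {..<n}" "u \<in> C" "y < n" "y \<notin> C" "k < n"
  shows "new_rep rep C y (u * n + k) =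
    (if k = cls (u * n + y) \<and> rep (u * n + k) = 0 then Suc y else rep (u * n + k))"
proof -
  have "u * n + k \<in> (\<lambda>u. u * n + cls (u * n + y)) ` C \<longleftrightarrow> k = cls (u * n + y)"
  proof
    assume "u * n + k \<in> (\<lambda>u. u * n + cls (u * n + y)) ` C"
    then obtain v where v: "v \<in> C" "u * n + k = v * n + cls (v * n + y)" by auto
    moreover from v assms have "cls (v * n + y) < n"
      by (intro cls_less) auto
    ultimately show "k = cls (u * n + y)"
      using assms by auto
  qed (use assms in auto)
  then show ?thesis by (simp add: new_rep_def)
qed

lemma new_rep_notin:
  assumes "C \<subseteq> {..<n}" "u \<notin> C" "y < n" "y \<notin> C" "k < n"
  shows "new_rep rep C y (u * n + k) = rep (u * n + k)"
proof -
  have "u * n + k \<notin> (\<lambda>u. u * n + cls (u * n + y)) ` C"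
  proof
    assume "u * n + k \<in> (\<lambda>u. u * n + cls (u * n + y)) ` C"
    then obtain v where v: "v \<in> C" "u * n + k = v * n + cls (v * n + y)" by auto
    moreover from v assms have "cls (v * n + y) < n"
      by (intro cls_less) auto
    ultimately show False
      using assms by auto
  qed
  then show ?thesis by (simp add: new_rep_def)
qed

lemma new_rep_pos: "rep a \<noteq> 0 \<Longrightarrow> new_rep rep C y a = rep a"
  by (simp add: new_rep_def)

lemma new_rep_label:
  assumes "u \<in> C"
  shows "label (new_rep rep C y) u y = (if label rep u y = 0 then Suc y else label rep u y)"
  using assms by (auto simp: new_rep_def)

lemma rep_inv_new_rep:
  assumes "rep_inv rep" "C \<subseteq> {..<n}" "y < n" "y \<notin> C"
  shows "rep_inv (new_rep rep C y)"
  unfolding rep_inv_def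
proof (intro allI impI)
  fix u k r
  assume *: "u < n" "k < n" "new_rep rep C y (u * n + k) = Suc r"
  show "r < n \<and> cls (u * n + r) = k"
  proof (cases "u \<in> C")
    case True
    consider "rep (u * n + k) = Suc r" | "k = cls (u * n + y)" "r = y"
      using *(3) new_rep_in[OF assms(2) True assms(3,4) *(2), of rep]
      by (auto split: if_splits)
    then show ?thesis
      using assms(1,3) * unfolding rep_inv_def by cases blast+
  next
    case False
    then have "rep (u * n + k) = Suc r"
      using *(3) new_rep_notin[OF assms(2) False assms(3,4) *(2), of rep] by simp
    then show ?thesis
      using assms(1) * unfolding rep_inv_def by blast
  qed
qed

text \<open>If the part of \<open>u\<close> and \<open>u'\<close> is the one compared with
  \<open>y\<close>, then \<open>y\<close> lies outside \<open>V\<close>. The umodule property then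
  fills the slot of \<open>x\<close> at \<open>u\<close> exactly when it fills the slot of
  \<open>x\<close> at \<open>u'\<close>.\<close>

lemma coherent_new_rep:
  assumes "coherent part rep" "C = {u. u < n \<and> part u = c}" "y < n" "y \<notin> C"
  shows "coherent part (new_rep rep C y)"
  unfolding coherent_def
proof (intro allI impI)
  fix V u u'
  assume V: "umodule_in_side X H S V" and u: "u < n" "u' < n" "xs ! u \<in> V" "xs ! u' \<in> V"
  have coh: "part v = part v' \<and> (\<forall>x<n. xs ! x \<notin> V \<longrightarrow> label rep v x = label rep v' x)"
    if "v < n" "v' < n" "xs ! v \<in> V" "xs ! v' \<in> V" for v v'
    using assms(1) V that unfolding coherent_def by blast
  have sub: "C \<subseteq> {..<n}" using assms by auto
  have "label (new_rep rep C y) u x = label (new_rep rep C y) u' x"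
    if x: "x < n" "xs ! x \<notin> V" for x
  proof -
    have ne: "x \<noteq> u" "x \<noteq> u'" using x u by auto
    have lt: "cls (u * n + x) < n" "cls (u' * n + x) < n"
      using x u ne by (auto intro: cls_less)
    show ?thesis
    proof (cases "u \<in> C")
      case True
      then have True': "u' \<in> C" using coh[of u u'] u assms by auto
      \<comment> \<open>By coherence \<open>V\<close> lies within one part, here \<open>C\<close>,
        and \<open>y\<close> is not in \<open>C\<close>.\<close>
      have yV: "xs ! y \<notin> V"
      proof
        assume "xs ! y \<in> V"
        then have "part u = part y" using coh[of u y] u assms by auto
        then show False using True assms by auto
      qed
      then have ney: "y \<noteq> u" "y \<noteq> u'" using u by auto
      have "H (xs ! u) (xs ! x) (xs ! y) \<longleftrightarrow> H (xs ! u') (xs ! x) (xs ! y)"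
        using V u x yV nth_in_X[OF x(1)] nth_in_X[OF assms(3)]
        unfolding umodule_in_side_def umodule_def by (meson DiffI)
      \<comment> \<open>So \<open>x\<close> shares the slot of \<open>y\<close> at both elements or
        at neither. Since the old labels at \<open>x\<close> agree, the slot is empty at both or at
        neither, and the new labels agree too.\<close>
      then have "cls (u * n + x) = cls (u * n + y) \<longleftrightarrow> cls (u' * n + x) = cls (u' * n + y)"
        using cls_eq[of u x y] cls_eq[of u' x y] u x ne ney assms(3) by auto
      moreover have "label rep u x = label rep u' x"
        using coh[of u u'] u x by auto
      ultimately show ?thesis
        using new_rep_in[OF sub True assms(3,4) lt(1)] new_rep_in[OF sub True' assms(3,4) lt(2)]
          coh[of u u'] u x yV assms(3) by auto
    next
      case False
      then have False': "u' \<notin> C" using coh[of u u'] u assms by auto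
      have "label rep u x = label rep u' x"
        using coh[of u u'] u x by auto
      then show ?thesis
        using new_rep_notin[OF sub False assms(3,4) lt(1)]
          new_rep_notin[OF sub False' assms(3,4) lt(2)] by simp
    qed
  qed
  then show "part u = part u' \<and>
      (\<forall>x<n. xs ! x \<notin> V \<longrightarrow> label (new_rep rep C y) u x = label (new_rep rep C y) u' x)"
    using coh[of u u'] u by auto
qed

text \<open>Settled labels are nonzero, and only empty slots are written.\<close>

lemma done_inv_new_rep:
  assumes "done_inv part m rep dn"
  shows "done_inv part m (new_rep rep C y) dn"
  unfolding done_inv_def
proof (intro allI impI conjI)
  fix d z u u'
  assume "d < m" "z < n" "dn (d * n + z) = 1" "u < n" "u' < n" "part u = d" "part u' = d"
  then have "label rep u z = label rep u' z \<and> label rep u z \<noteq> 0"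
    using assms unfolding done_inv_def by blast
  then show "label (new_rep rep C y) u z = label (new_rep rep C y) u' z"
    "label (new_rep rep C y) u z \<noteq> 0"
    by (simp_all add: new_rep_pos)
qed (use assms in \<open>auto simp: done_inv_def\<close>)

section \<open>Preservation of the invariant by the steps of the scan\<close>

lemma step_no_split:
  assumes inv: "refine_inv part m mem sz rep dn c y"
    and c: "c < m" and y: "y < n" "part y \<noteq> c" "dn (c * n + y) = 0"
    and C: "C = {u. u < n \<and> part u = c}"
    and same: "\<And>u. u \<in> C \<Longrightarrow> label (new_rep rep C y) u y = L"
  shows "refine_inv part m mem sz (new_rep rep C y) (dn(c * n + y := 1)) c (Suc y)"
proof -
  have i: "parts_inv part m mem sz" "rep_inv rep" "coherent part rep"
    "done_inv part m rep dn" "scan_inv part m dn c y"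
    using inv unfolding refine_inv_def by auto
  have yC: "y \<notin> C" "C \<subseteq> {..<n}" using y C by auto
  have d: "done_inv part m (new_rep rep C y) dn"
    using i by (rule_tac done_inv_new_rep)
  have D: "done_inv part m (new_rep rep C y) (dn(c * n + y := 1))"
    unfolding done_inv_def
  proof (intro allI impI, goal_cases)
    case (1 d z)
    show ?case
    proof (cases "d = c \<and> z = y")
      case True
      have "label (new_rep rep C y) u z = L" "L \<noteq> 0" if "u < n" "part u = c" for u
        using same[of u] new_rep_label[of u C rep y] that C True by (auto split: if_splits)
      then show ?thesis using True y by auto
    next
      case False
      then have eq: "(dn(c * n + y := 1)) (d * n + z) = dn (d * n + z)"
        using 1 y by auto
      show ?thesis
        unfolding eq using d 1 unfolding done_inv_def by blast
    qed
  qed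
  have Sc: "scan_inv part m (dn(c * n + y := 1)) c (Suc y)"
    using i(5) y unfolding scan_inv_def by (auto simp: less_Suc_eq)
  have co: "coherent part (new_rep rep C y)"
    using i C y yC by (intro coherent_new_rep) auto
  have re: "rep_inv (new_rep rep C y)"
    using i y yC by (intro rep_inv_new_rep) auto
  show ?thesis
    using i(1) re co D Sc by (rule refine_invI)
qed

text \<open>
  Umodules inside \<open>C\<close> are not cut by the split: \<open>y\<close> lies outside, so coherence of the new
  representatives at \<open>y\<close> makes the labels of their elements equal.
\<close>

lemma step_split:
  assumes inv: "refine_inv part m mem sz rep dn c y"
    and c: "c < m" and y: "y < n" "part y \<noteq> c"
    and C: "C = {u. u < n \<and> part u = c}"
    and keep: "\<And>u. keep u \<longleftrightarrow> label (new_rep rep C y) u y = L"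
    and nonempty: "\<exists>u\<in>C. keep u" "\<exists>u\<in>C. \<not> keep u"
    and part': "\<And>u. u < n \<Longrightarrow> part' u = (if u \<in> C \<and> \<not> keep u then m else part u)"
    and mem': "row n mem' c j = filter keep (row n mem c (sz c))"
      "row n mem' m h = filter (\<lambda>u. \<not> keep u) (row n mem c (sz c))"
      "\<And>d i. d < m \<Longrightarrow> d \<noteq> c \<Longrightarrow> i < n \<Longrightarrow> mem' (d * n + i) = mem (d * n + i)"
    and dn': "\<And>d z. d < m \<Longrightarrow> z < n \<Longrightarrow> dn' (d * n + z) = dn (d * n + z)"
      "\<And>z. z < n \<Longrightarrow> dn' (m * n + z) = dn (c * n + z)"
  shows "refine_inv part' (Suc m) mem' (sz(c := j, m := h)) (new_rep rep C y) dn' c 0"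
proof -
  have i: "parts_inv part m mem sz" "rep_inv rep" "coherent part rep"
    "done_inv part m rep dn" "scan_inv part m dn c y"
    using inv unfolding refine_inv_def by auto
  have yC: "y \<notin> C" "C \<subseteq> {..<n}" using y C by auto
  have lt: "part u < m" if "u < n" for u
    using i(1) that unfolding parts_inv_def by auto
  have rowC: "distinct (row n mem c (sz c))" "set (row n mem c (sz c)) = C"
    using i(1) c C unfolding parts_inv_def by auto
  have part'_eq: "part' u = c \<longleftrightarrow> u \<in> C \<and> keep u" "part' u = m \<longleftrightarrow> u \<in> C \<and> \<not> keep u"
    "d < m \<Longrightarrow> d \<noteq> c \<Longrightarrow> part' u = d \<longleftrightarrow> part u = d" if "u < n" for u d
    using part'[OF that] lt[OF that] that C c by auto
  let ?sz = "sz(c := j, m := h)"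
  have P: "parts_inv part' (Suc m) mem' ?sz"
    unfolding parts_inv_def
  proof (intro conjI allI impI, goal_cases)
    case (1 u)
    then show ?case using part' lt[of u] by auto
  next
    case (2 d)
    consider "d = c" | "d = m" | "d < m" "d \<noteq> c" using 2 by linarith
    then show ?case
    proof cases
      case 1
      have "filter keep (row n mem c (sz c)) \<noteq> []"
        using nonempty(1) rowC by (auto simp: filter_empty_conv)
      then have "row n mem' c j \<noteq> []" using mem' by simp
      then show ?thesis using 1 c by (cases j) auto
    next
      case 2
      have "filter (\<lambda>u. \<not> keep u) (row n mem c (sz c)) \<noteq> []"
        using nonempty(2) rowC by (auto simp: filter_empty_conv)
      then have "row n mem' m h \<noteq> []" using mem' by simp
      then show ?thesis using 2 c by (cases h) auto
    next
      case 3
      then show ?thesis using i(1) unfolding parts_inv_def by auto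
    qed
  next
    case (3 d)
    consider "d = c" | "d = m" | "d < m" "d \<noteq> c" using 3 by linarith
    then show ?case
    proof cases
      case 1
      then show ?thesis using mem' rowC c by auto
    next
      case 2
      then show ?thesis using mem' rowC c by auto
    next
      case d: 3
      then have "row n mem' d (?sz d) = row n mem d (sz d)"
        using mem'(3)[of d] size_le[OF i(1), of d] by (auto intro!: row_cong)
      then show ?thesis using i(1) d unfolding parts_inv_def by auto
    qed
  next
    case (4 d)
    consider "d = c" | "d = m" | "d < m" "d \<noteq> c" using 4 by linarith
    then show ?case
    proof cases
      case 1
      have "set (row n mem' d (?sz d)) = {u \<in> C. keep u}"
        using 1 mem'(1) rowC(2) c by simp
      also have "\<dots> = {u. u < n \<and> part' u = d}"
        using 1 part'_eq(1) yC(2) by blast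
      finally show ?thesis .
    next
      case 2
      have "set (row n mem' d (?sz d)) = {u \<in> C. \<not> keep u}"
        using 2 mem'(2) rowC(2) c by simp
      also have "\<dots> = {u. u < n \<and> part' u = d}"
        using 2 part'_eq(2) yC(2) by blast
      finally show ?thesis .
    next
      case d: 3
      then have "row n mem' d (?sz d) = row n mem d (sz d)"
        using mem'(3)[of d] size_le[OF i(1), of d] by (auto intro!: row_cong)
      then have "set (row n mem' d (?sz d)) = {u. u < n \<and> part u = d}"
        using i(1) d unfolding parts_inv_def by auto
      also have "\<dots> = {u. u < n \<and> part' u = d}"
        using part'_eq(3) d by blast
      finally show ?thesis .
    qed
  next
    case (5 u u')
    then have "part u = part u'"
      using part'[of u] part'[of u'] lt[of u] lt[of u'] C by (auto split: if_splits)
    then show ?case using i(1) 5 unfolding parts_inv_def by blast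
  qed
  have rep': "rep_inv (new_rep rep C y)"
    using i y yC by (intro rep_inv_new_rep) auto
  have coh: "coherent part (new_rep rep C y)"
    using i C y yC by (intro coherent_new_rep) auto
  have co': "coherent part' (new_rep rep C y)"
    unfolding coherent_def
  proof (intro allI impI)
    fix V u u'
    assume V: "umodule_in_side X H S V" and u: "u < n" "u' < n" "xs ! u \<in> V" "xs ! u' \<in> V"
    have co: "part v = part v' \<and> (\<forall>x<n. xs ! x \<notin> V \<longrightarrow>
        label (new_rep rep C y) v x = label (new_rep rep C y) v' x)"
      if "v < n" "v' < n" "xs ! v \<in> V" "xs ! v' \<in> V" for v v'
      using coh V that unfolding coherent_def by blast
    have "part' u = part' u'"
    proof (cases "u \<in> C")
      case True
      then have "u' \<in> C" using co[of u u'] u C by auto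
      moreover have "xs ! y \<notin> V"
        using co[of u y] u True C y by auto
      then have "label (new_rep rep C y) u y = label (new_rep rep C y) u' y"
        using co[of u u'] u y by blast
      ultimately show ?thesis
        using True part' u co[of u u'] keep by auto
    next
      case False
      then have "u' \<notin> C" using co[of u u'] u C by auto
      then show ?thesis
        using False part' u co[of u u'] by auto
    qed
    then show "part' u = part' u' \<and> (\<forall>x<n. xs ! x \<notin> V \<longrightarrow>
        label (new_rep rep C y) u x = label (new_rep rep C y) u' x)"
      using co[of u u'] u by blast
  qed
  have D: "done_inv part' (Suc m) (new_rep rep C y) dn'"
    unfolding done_inv_def
  proof (intro allI impI, goal_cases)
    case (1 d z)
    \<comment> \<open>\<open>e\<close> is the old part that contains the new part \<open>d\<close>,
      and the flags of \<open>d\<close> are those of \<open>e\<close>. So everything about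
      \<open>d\<close> follows from the old statement about \<open>e\<close>.\<close>
    define e where "e = (if d = m then c else d)"
    have e: "e < m" "dn' (d * n + z) = dn (e * n + z)"
      using 1 c dn' unfolding e_def by auto
    have sub: "part u = e" if "u < n" "part' u = d" for u
      using that part'[of u] lt[of u] C 1 c unfolding e_def by (auto split: if_splits)
    have "done_inv part m (new_rep rep C y) dn"
      using i(4) by (rule done_inv_new_rep)
    then have *: "dn (e * n + z) \<le> 1" "dn (e * n + z) = 1 \<Longrightarrow> part z \<noteq> e"
      "\<And>u u'. \<lbrakk>dn (e * n + z) = 1; u < n; u' < n; part u = e; part u' = e\<rbrakk> \<Longrightarrow>
        label (new_rep rep C y) u z = label (new_rep rep C y) u' z \<and>
        label (new_rep rep C y) u z \<noteq> 0"
      using e(1) 1 unfolding done_inv_def by blast+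
    show ?case
      unfolding e(2)
    proof (intro conjI impI allI)
      show "dn (e * n + z) \<le> 1" by (rule *(1))
      show "part' z \<noteq> d" if "dn (e * n + z) = 1"
        using *(2)[OF that] sub[of z] 1 by blast
      fix u u'
      assume "dn (e * n + z) = 1" "u < n" "u' < n" "part' u = d" "part' u' = d"
      then have "label (new_rep rep C y) u z = label (new_rep rep C y) u' z \<and>
          label (new_rep rep C y) u z \<noteq> 0"
        by (intro *(3)) (auto intro: sub)
      then show "label (new_rep rep C y) u z = label (new_rep rep C y) u' z"
        "label (new_rep rep C y) u z \<noteq> 0" by auto
    qed
  qed
  \<comment> \<open>All moved elements come from \<open>c\<close>, so parts below \<open>c\<close>
    have the same members as before. For \<open>c\<close> itself the scan restarts and nothing is
    claimed.\<close>
  have Sc: "scan_inv part' (Suc m) dn' c 0"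
  proof -
    have "dn' (d * n + z) = 1" if *: "d < c" "z < n" "part' z \<noteq> d" for d z
    proof -
      have "part z \<noteq> d" using * part'[of z] C by (auto split: if_splits)
      then show ?thesis using i(5) * c dn' unfolding scan_inv_def by auto
    qed
    then show ?thesis using c unfolding scan_inv_def by auto
  qed
  show ?thesis
    using P rep' co' D Sc by (rule refine_invI)
qed

lemma step_skip:
  assumes "refine_inv part m mem sz rep dn c y" "c < m" "y < n"
    and "part y = c \<or> dn (c * n + y) \<noteq> 0"
  shows "refine_inv part m mem sz rep dn c (Suc y)"
proof -
  have "done_inv part m rep dn" "scan_inv part m dn c y"
    using assms(1) unfolding refine_inv_def by auto
  moreover have "dn (c * n + y) \<le> 1"
    using \<open>done_inv part m rep dn\<close> assms(2,3) unfolding done_inv_def by blast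
  ultimately have "scan_inv part m dn c (Suc y)"
    using assms(2,3,4) unfolding scan_inv_def by (auto simp: less_Suc_eq)
  then show ?thesis using assms(1) unfolding refine_inv_def by blast
qed

lemma step_next:
  assumes "refine_inv part m mem sz rep dn c n" "c < m"
  shows "refine_inv part m mem sz rep dn (Suc c) 0"
  using assms unfolding refine_inv_def scan_inv_def by (auto simp: less_Suc_eq)

section \<open>The parts of a finished scan are those of \<open>MU\<close>\<close>

definition part_sets where
  "part_sets part m = (\<lambda>c. (!) xs ` {u. u < n \<and> part u = c}) ` {..<m}"

text \<open>Equivalent outside elements have the same label at \<open>u\<close>. All comparisons are
  settled, so their labels at \<open>u'\<close> are these same nonzero values, and
  \<open>rep_inv\<close> turns the common label at \<open>u'\<close> back into a common
  class.\<close>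

lemma refined_umodule:
  assumes inv: "refine_inv part m mem sz rep dn m y" and c: "c < m"
  shows "umodule_in_side X H S ((!) xs ` {u. u < n \<and> part u = c})"
proof -
  let ?U = "(!) xs ` {u. u < n \<and> part u = c}"
  have i: "parts_inv part m mem sz" "rep_inv rep"
    "done_inv part m rep dn" "scan_inv part m dn m y"
    using inv unfolding refine_inv_def by auto
  have imp: "cls (u' * n + x) = cls (u' * n + x')"
    if u: "u < n" "u' < n" "part u = c" "part u' = c" "x < n" "x' < n" "part x \<noteq> c" "part x' \<noteq> c"
      and eq: "cls (u * n + x) = cls (u * n + x')" for u u' x x'
  proof -
    have d: "dn (c * n + x) = 1" "dn (c * n + x') = 1"
      using i(4) u c unfolding scan_inv_def by auto
    have l: "label rep u x = label rep u' x" "label rep u x \<noteq> 0"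
      "label rep u x' = label rep u' x'"
      using i(3) c d u unfolding done_inv_def by blast+
    then obtain r where r: "label rep u' x = Suc r" by (metis not0_implies_Suc)
    with l eq have r': "label rep u' x' = Suc r" by simp
    have "cls (u' * n + x) < n" "cls (u' * n + x') < n"
      using u by (auto intro: cls_less)
    then have "cls (u' * n + r) = cls (u' * n + x)" "cls (u' * n + r) = cls (u' * n + x')"
      using i(2) r r' u unfolding rep_inv_def by blast+
    then show ?thesis by simp
  qed
  have "umodule X H ?U"
    unfolding umodule_def
  proof (intro conjI ballI)
    show "?U \<subseteq> X" by auto
  next
    fix u u' x x'
    assume "u \<in> ?U" "u' \<in> ?U" "x \<in> X - ?U" "x' \<in> X - ?U"
    moreover from this obtain a a' b b' where *: "u = xs ! a" "u' = xs ! a'" "x = xs ! b" "x' = xs ! b'"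
      "a < n" "a' < n" "part a = c" "part a' = c" "b < n" "b' < n"
      using set_xs n_def by (auto simp: in_set_conv_nth)
    ultimately have pb: "part b \<noteq> c" "part b' \<noteq> c" by auto
    have "cls (a * n + b) = cls (a * n + b') \<longleftrightarrow> cls (a' * n + b) = cls (a' * n + b')"
      using imp[of a a' b b'] imp[of a' a b b'] * pb by blast
    moreover have "cls (a * n + b) = cls (a * n + b') \<longleftrightarrow> H u x x'"
      using cls_eq[of a b b'] * pb by auto
    moreover have "cls (a' * n + b) = cls (a' * n + b') \<longleftrightarrow> H u' x x'"
      using cls_eq[of a' b b'] * pb by auto
    ultimately show "H u x x' \<longleftrightarrow> H u' x x'" by simp
  qed
  moreover have "?U \<subseteq> S \<or> ?U \<subseteq> X - S"
  proof (rule disjCI)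
    assume "\<not> ?U \<subseteq> X - S"
    then obtain u where "u < n" "part u = c" "xs ! u \<in> S" by auto
    then show "?U \<subseteq> S"
      using i(1) unfolding parts_inv_def by blast
  qed
  ultimately show ?thesis unfolding umodule_in_side_def by blast
qed

text \<open>Coherence puts every nonempty candidate inside one part, and every part is itself a
  candidate; as the parts are disjoint, they are the maximal candidates. That \<open>MU\<close> is a
  partition becomes a consequence of this.\<close>

lemma part_sets_eq_MU:
  assumes inv: "refine_inv part m mem sz rep dn m y"
  shows "part_sets part m = MU X H S"
proof -
  have i: "parts_inv part m mem sz" "coherent part rep"
    using inv unfolding refine_inv_def by auto
  define U where "U c = (!) xs ` {u. u < n \<and> part u = c}" for c
  have U_sub: "\<exists>c<m. V \<subseteq> U c" if V: "umodule_in_side X H S V" "V \<noteq> {}" for V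
  proof -
    have "V \<subseteq> X" using V unfolding umodule_in_side_def umodule_def by auto
    have "\<exists>v<n. v0 = xs ! v" if "v0 \<in> V" for v0
      using that \<open>V \<subseteq> X\<close> set_xs n_def by (metis in_set_conv_nth subsetD)
    moreover obtain u0 where "u0 \<in> V" using V by auto
    ultimately obtain u where u: "u < n" "xs ! u \<in> V" by auto
    have "V \<subseteq> U (part u)"
    proof
      fix v0
      assume "v0 \<in> V"
      then obtain v where v: "v < n" "v0 = xs ! v"
        using \<open>\<And>v0. v0 \<in> V \<Longrightarrow> \<exists>v<n. v0 = xs ! v\<close> by blast
      then have "part v = part u"
        using i(2) V(1) u \<open>v0 \<in> V\<close> unfolding coherent_def by blast
      then show "v0 \<in> U (part u)" using v unfolding U_def by blast
    qed
    then show ?thesis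
      using i(1) u unfolding parts_inv_def by blast
  qed
  have U_umod: "umodule_in_side X H S (U c)" if "c < m" for c
    using refined_umodule[OF inv that] unfolding U_def .
  have U_ne: "U c \<noteq> {}" if c: "c < m" for c
  proof -
    have "row n mem c (sz c) ! 0 \<in> set (row n mem c (sz c))"
      using i(1) c unfolding parts_inv_def by (intro nth_mem) simp
    then show ?thesis
      using i(1) c unfolding parts_inv_def U_def by auto
  qed
  have U_disj: "c = d" if "x \<in> U c" "x \<in> U d" for c d x
    using that distinct_xs n_def unfolding U_def by (auto simp: nth_eq_iff_index_eq)
  have max: "V = U c" if "c < m" "umodule_in_side X H S V" "U c \<subseteq> V" for c V
  proof -
    have "V \<noteq> {}" using U_ne[OF \<open>c < m\<close>] \<open>U c \<subseteq> V\<close> by blast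
    then obtain d where "d < m" "V \<subseteq> U d" using U_sub[OF \<open>umodule_in_side X H S V\<close>] by blast
    moreover obtain x where "x \<in> U c" using U_ne[OF \<open>c < m\<close>] by blast
    ultimately have "c = d" using U_disj \<open>U c \<subseteq> V\<close> by blast
    then show ?thesis using \<open>V \<subseteq> U d\<close> \<open>U c \<subseteq> V\<close> by blast
  qed
  have "U ` {..<m} = MU X H S"
  proof (intro equalityI subsetI)
    fix A assume "A \<in> U ` {..<m}"
    then show "A \<in> MU X H S"
      unfolding MU_def using U_ne U_umod max by blast
  next
    fix A assume A: "A \<in> MU X H S"
    then obtain c where c: "c < m" "A \<subseteq> U c"
      using U_sub unfolding MU_def by blast
    then have "U c = A" using A U_umod unfolding MU_def by blast
    then show "A \<in> U ` {..<m}" using c by blast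
  qed
  then show ?thesis unfolding part_sets_def U_def .
qed

end

section \<open>Frames and reading the input\<close>

text \<open>For loops that consume a list: the proof is an induction on the list and unfolds the
  loop once per entry. Loops with a genuine invariant use \<open>wpt_While\<close> or
  \<open>wpt_While_frame\<close> instead.\<close>

lemma wpt_While_unfold:
  "wpt w (While b c) Q s N \<longleftrightarrow> bfits w b s \<and> 1 + bcost b \<le> N \<and>
     (if bval b s then wpt w c (wpt w (While b c) Q) s (N - (1 + bcost b))
      else Q s (N - (1 + bcost b)))"
  (is "?L \<longleftrightarrow> ?R")
proof
  assume ?L
  then obtain k t where "runs w (While b c) s k t" "k \<le> N" "Q t (N - k)"
    unfolding wpt_def by blast
  then show ?R
  proof cases
    case runs_WhileFalse
    then show ?thesis using \<open>k \<le> N\<close> \<open>Q t (N - k)\<close> by auto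
  next
    case (runs_WhileTrue k1 t1 l)
    then have "wpt w (While b c) Q t1 (N - (1 + bcost b) - k1)"
      unfolding wpt_def using \<open>k \<le> N\<close> \<open>Q t (N - k)\<close>
      by (intro exI[of _ l] exI[of _ t]) auto
    moreover have "k1 \<le> N - (1 + bcost b)" "1 + bcost b \<le> N"
      using runs_WhileTrue \<open>k \<le> N\<close> by auto
    ultimately show ?thesis
      using runs_WhileTrue unfolding wpt_def[of w c] by auto
  qed
next
  assume R: ?R
  show ?L
  proof (cases "bval b s")
    case True
    with R obtain k t l u where "runs w c s k t" "k \<le> N - (1 + bcost b)"
      "runs w (While b c) t l u" "l \<le> N - (1 + bcost b) - k" "Q u (N - (1 + bcost b) - k - l)"
      unfolding wpt_def by auto
    with R True show ?thesis
      unfolding wpt_def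
      by (intro exI[of _ "1 + bcost b + k + l"] exI[of _ u])
        (use runs_WhileTrue[of w b s c k t l u] in auto)
  next
    case False
    with R show ?thesis
      unfolding wpt_def
      by (intro exI[of _ "1 + bcost b"] exI[of _ s]) (use runs_WhileFalse[of w b s c] in auto)
  qed
qed

fun assigned :: "com \<Rightarrow> string set" where
  "assigned (Assign x e) = {x}"
| "assigned (Seq c d) = assigned c \<union> assigned d"
| "assigned (Cond b c d) = assigned c \<union> assigned d"
| "assigned (While b c) = assigned c"
| "assigned _ = {}"

fun written :: "com \<Rightarrow> string set" where
  "written (Write a e f) = {a}"
| "written (Seq c d) = written c \<union> written d"
| "written (Cond b c d) = written c \<union> written d"
| "written (While b c) = written c"
| "written _ = {}"

lemma runs_frame:
  assumes "runs w c s k t"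
  shows "(\<forall>x. x \<notin> assigned c \<longrightarrow> vars t x = vars s x) \<and>
    (\<forall>a. a \<notin> written c \<longrightarrow> arrays t a = arrays s a)"
  using assms by induction auto

text \<open>Specifications of the loops mention only what they change. All other variables and
  arrays are recovered here from the program text.\<close>

lemma wpt_use:
  assumes "wpt w c P s N"
    and "\<And>t M. \<lbrakk>P t M; \<And>x. x \<notin> assigned c \<Longrightarrow> vars t x = vars s x;
      \<And>a. a \<notin> written c \<Longrightarrow> arrays t a = arrays s a\<rbrakk> \<Longrightarrow> Q t M"
  shows "wpt w c Q s N"
  using assms(1) runs_frame[of w c s] assms(2) unfolding wpt_def by blast

lemma wpt_While_frame:
  assumes "I s N"
    and step: "\<And>t M. \<lbrakk>I t M; \<And>x. x \<notin> assigned c \<Longrightarrow> vars t x = vars s x;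
      \<And>a. a \<notin> written c \<Longrightarrow> arrays t a = arrays s a\<rbrakk> \<Longrightarrow> bfits w b t \<and> 1 + bcost b \<le> M \<and>
      (if bval b t then wpt w c I t (M - (1 + bcost b)) else Q t (M - (1 + bcost b)))"
  shows "wpt w (While b c) Q s N"
proof (rule wpt_While[where I = "\<lambda>t M. I t M \<and> (\<forall>x. x \<notin> assigned c \<longrightarrow> vars t x = vars s x) \<and>
    (\<forall>a. a \<notin> written c \<longrightarrow> arrays t a = arrays s a)"], goal_cases)
  case 1
  then show ?case using assms(1) by simp
next
  case (2 t M)
  then have fr: "\<And>x. x \<notin> assigned c \<Longrightarrow> vars t x = vars s x"
    "\<And>a. a \<notin> written c \<Longrightarrow> arrays t a = arrays s a" by blast+
  note st = step[OF conjunct1[OF 2] fr]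
  show ?case
  proof (cases "bval b t")
    case True
    with st have "wpt w c I t (M - (1 + bcost b))" by simp
    then have "wpt w c (\<lambda>t' M'. I t' M' \<and> (\<forall>x. x \<notin> assigned c \<longrightarrow> vars t' x = vars s x) \<and>
        (\<forall>a. a \<notin> written c \<longrightarrow> arrays t' a = arrays s a)) t (M - (1 + bcost b))"
      by (rule wpt_use) (use fr in simp)
    with st True show ?thesis by simp
  next
    case False
    with st show ?thesis by simp
  qed
qed

lemma afits_simps [simp]:
  "afits w (Const k) s \<longleftrightarrow> k < 2 ^ w"
  "afits w (Var x) s \<longleftrightarrow> vars s x < 2 ^ w"
  "afits w (Read a e) s \<longleftrightarrow> arrays s a (aval e s) < 2 ^ w \<and> afits w e s"
  "afits w (Plus e f) s \<longleftrightarrow> aval e s + aval f s < 2 ^ w \<and> afits w e s \<and> afits w f s"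
  "afits w (Minus e f) s \<longleftrightarrow> aval e s - aval f s < 2 ^ w \<and> afits w e s \<and> afits w f s"
  "afits w (Times e f) s \<longleftrightarrow> aval e s * aval f s < 2 ^ w \<and> afits w e s \<and> afits w f s"
  by (auto simp: afits_def)

definition stored :: "(nat \<Rightarrow> nat) \<Rightarrow> nat \<Rightarrow> nat list \<Rightarrow> bool" where
  "stored f t l \<longleftrightarrow> (\<forall>j<length l. f (t + j) = l ! j)"

lemma stored_Nil [simp]: "stored f t []"
  by (simp add: stored_def)

lemma stored_Cons [simp]: "stored f t (x # l) \<longleftrightarrow> f t = x \<and> stored f (Suc t) l"
  by (auto simp: stored_def All_less_Suc2)

lemma stored_append [simp]:
  "stored f t (l @ l') \<longleftrightarrow> stored f t l \<and> stored f (t + length l) l'"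
  by (induction l arbitrary: t) auto

text \<open>
  The effects of the parsing loops are functions that recurse over the list in the same order as
  the loop, so that the loop lemmas follow by induction on the list.
\<close>

primrec set_class :: "nat \<Rightarrow> nat \<Rightarrow> nat list \<Rightarrow> (nat \<Rightarrow> nat) \<Rightarrow> nat \<Rightarrow> nat" where
  "set_class b k [] f = f"
| "set_class b k (x # l) f = set_class b k l (f(b + x := k))"

primrec set_classes :: "nat \<Rightarrow> nat \<Rightarrow> nat list list \<Rightarrow> (nat \<Rightarrow> nat) \<Rightarrow> nat \<Rightarrow> nat" where
  "set_classes b k [] f = f"
| "set_classes b k (l # ls) f = set_classes b (Suc k) ls (set_class b k l f)"

primrec set_relation :: "nat \<Rightarrow> nat \<Rightarrow> nat list list list \<Rightarrow> (nat \<Rightarrow> nat) \<Rightarrow> nat \<Rightarrow> nat" where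
  "set_relation n i [] f = f"
| "set_relation n i (ls # hs) f = set_relation n (Suc i) hs (set_classes (i * n) 0 ls f)"

lemma set_class_apply:
  "set_class b k l f a = (if a \<in> (+) b ` set l then k else f a)"
  by (induction l arbitrary: f) auto

lemma set_classes_other:
  "a \<notin> (+) b ` set (concat ls) \<Longrightarrow> set_classes b k ls f a = f a"
  by (induction ls arbitrary: k f) (simp_all add: set_class_apply image_Un)

lemma set_classes_nth:
  assumes "distinct (concat ls)" "j < length ls" "x \<in> set (ls ! j)"
  shows "set_classes b k ls f (b + x) = k + j"
  using assms
proof (induction ls arbitrary: k f j)
  case (Cons l ls)
  show ?case
  proof (cases j)
    case 0
    then have "b + x \<notin> (+) b ` set (concat ls)"
      using Cons.prems by auto
    then show ?thesis
      using 0 Cons.prems by (simp add: set_classes_other set_class_apply)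
  next
    case (Suc j')
    then show ?thesis using Cons.prems Cons.IH[of j' "Suc k"] by simp
  qed
qed simp

lemma set_relation_less: "a < i * n \<Longrightarrow> set_relation n i hs f a = f a"
proof (induction hs arbitrary: i f)
  case (Cons ls hs)
  then have "a \<notin> (+) (i * n) ` set (concat ls)" by auto
  then show ?case using Cons by (simp add: set_classes_other)
qed simp

lemma set_relation_nth:
  assumes "\<And>ls. ls \<in> set hs \<Longrightarrow> set (concat ls) \<subseteq> {..<n} \<and> distinct (concat ls)"
    and "u < length hs" "j < length (hs ! u)" "x \<in> set (hs ! u ! j)"
  shows "set_relation n i hs f ((i + u) * n + x) = j"
  using assms
proof (induction hs arbitrary: i u f)
  case (Cons ls hs)
  show ?case
  proof (cases u)
    case 0
    with Cons.prems have j: "j < length ls" "x \<in> set (ls ! j)" and d: "distinct (concat ls)"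
      and "set (concat ls) \<subseteq> {..<n}" by auto
    then have "x < n" by (auto dest: nth_mem)
    then show ?thesis using 0 j d by (simp add: set_relation_less set_classes_nth)
  next
    case (Suc u')
    then show ?thesis using Cons.prems Cons.IH[of u' "Suc i"] by simp
  qed
qed simp

text \<open>The bound covers the addresses of all \<open>n\<close> by \<open>n\<close> matrices as
  well as those of the input: each of the \<open>n\<close> listings has at most
  \<open>2 * n + 1\<close> words, which gives at most \<open>2 * n * n + 2 * n + 2\<close> words
  together with the listing of \<open>S\<close> and the leading count.\<close>

locale machine =
  fixes w n :: nat
  assumes big: "2 * (n + 2) * (n + 2) \<le> 2 ^ w"
begin

lemma fits_small: "k \<le> 2 * n + 2 \<Longrightarrow> k < 2 ^ w"
  using big by (auto simp: algebra_simps)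

text \<open>Row number \<open>n\<close> is included because \<open>separate\<close> starts knowing
  only \<open>m \<le> n\<close>; that \<open>m\<close> is a legal number for a new part is clear
  only after a split has occurred.\<close>

lemma fits_address: "c \<le> n \<Longrightarrow> c * n < 2 ^ w" "c \<le> n \<Longrightarrow> i \<le> n \<Longrightarrow> c * n + i < 2 ^ w"
proof -
  show *: "c * n + i < 2 ^ w" if "c \<le> n" "i \<le> n" for c i
  proof -
    have "c * n \<le> n * n" using that by simp
    moreover have "2 * (n * n) + 8 * n + 8 \<le> 2 ^ w" using big by (simp add: algebra_simps)
    ultimately show ?thesis using that by linarith
  qed
  show "c * n < 2 ^ w" if "c \<le> n" for c
    using *[of c 0] that by simp
qed

lemma fits_one [simp]: "Suc 0 < 2 ^ w"
  by (rule fits_small) simp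

lemma wpt_parse_class:
  assumes "vars s ''n'' = n" "vars s ''i'' < n" "vars s ''k'' \<le> n"
    and "vars s ''j'' + length l = vars s ''r''" "vars s ''r'' \<le> n"
    and "stored (arrays s ''in'') (vars s ''t'') l" "vars s ''t'' + length l < 2 ^ w"
    and "set l \<subseteq> {..<n}" "40 * length l + 10 + B \<le> N"
  shows "wpt w parse_class (\<lambda>t M. B \<le> M \<and> vars t ''t'' = vars s ''t'' + length l \<and>
    arrays t ''cls'' = set_class (vars s ''i'' * n) (vars s ''k'') l (arrays s ''cls'')) s N"
  using assms
proof (induction l arbitrary: s N)
  case Nil
  then show ?case
    unfolding parse_class_def by (subst wpt_While_unfold) (simp add: fits_small)
next
  case (Cons x l)
  note p = Cons.prems
  have [simp]: "x < n" "x \<le> n" "x < 2 ^ w"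
    using p fits_small[of x] by auto
  have f: "vars s ''i'' * n + x < 2 ^ w" "vars s ''i'' * n < 2 ^ w" "n < 2 ^ w"
      "vars s ''i'' < 2 ^ w" "vars s ''j'' < 2 ^ w" "vars s ''r'' < 2 ^ w" "vars s ''k'' < 2 ^ w"
      "Suc (vars s ''j'') < 2 ^ w" "vars s ''t'' < 2 ^ w" "Suc (vars s ''t'') < 2 ^ w"
    using p by (simp_all add: fits_small fits_address)
  show ?case
    unfolding parse_class_def
    apply (subst wpt_While_unfold)
    apply (fold parse_class_def)
    using p f
    apply (simp del: One_nat_def)
    apply (intro conjI; (linarith)?)
    apply (rule wpt_mono)
     apply (rule Cons.IH)
             apply (simp_all add: fun_upd_def)
    done
qed

text \<open>Credits are counted per input word: the length word in front of a class pays for the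
  fixed work on this class, and each member pays for its turn of the inner loop. The higher rate of
  \<open>wpt_parse_relation\<close> has the same origin one level up.\<close>

lemma wpt_parse_partition:
  assumes "vars s ''n'' = n" "vars s ''i'' < n"
    and "vars s ''k'' + length ls = vars s ''q''" "vars s ''q'' \<le> n"
    and "stored (arrays s ''in'') (vars s ''t'') (concat (map enc_set ls))"
    and "vars s ''t'' + length (concat (map enc_set ls)) < 2 ^ w"
    and "set (concat ls) \<subseteq> {..<n}" "distinct (concat ls)"
    and "100 * length (concat (map enc_set ls)) + 10 + B \<le> N"
  shows "wpt w parse_partition (\<lambda>t M. B \<le> M \<and>
    vars t ''t'' = vars s ''t'' + length (concat (map enc_set ls)) \<and>
    arrays t ''cls'' =
      set_classes (vars s ''i'' * n) (vars s ''k'') ls (arrays s ''cls'')) s N"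
  using assms
proof (induction ls arbitrary: s N)
  case Nil
  then show ?case
    unfolding parse_partition_def by (subst wpt_While_unfold) (simp add: fits_small)
next
  case (Cons l ls)
  note p = Cons.prems
  have len: "length l \<le> n"
    using p(7,8) card_mono[of "{..<n}" "set l"] distinct_card[of l] by auto
  have f: "n < 2 ^ w" "vars s ''q'' < 2 ^ w" "vars s ''k'' < 2 ^ w" "length l < 2 ^ w"
      "vars s ''t'' < 2 ^ w" "Suc (vars s ''t'') < 2 ^ w" "Suc (vars s ''k'') < 2 ^ w"
    using p len by (simp_all add: fits_small enc_set_def)
  have d: "distinct (concat ls)" "set l \<subseteq> {..<n}" "\<Union> (set ` set ls) \<subseteq> {..<n}"
    using p(7,8) by auto
  show ?case
    unfolding parse_partition_def
    apply (subst wpt_While_unfold)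
    apply (fold parse_partition_def)
    using p(1-6,9) f
    apply (simp add: enc_set_def[of l] del: One_nat_def)
    apply (intro conjI; (linarith)?)
    apply (rule wpt_use)
     apply (rule wpt_parse_class[where l = l and
          B = "100 * length (concat (map enc_set ls)) + 50 + B"])
             apply (simp_all add: len d)[9]
    \<comment> \<open>The inner loop has been replaced by its specification; its text is unfolded
      only so that \<open>assigned\<close> and \<open>written\<close> evaluate and yield the
      frame.\<close>
    apply (simp add: parse_class_def del: One_nat_def)
    apply (intro conjI; (linarith)?)
    apply (rule wpt_mono)
     apply (rule Cons.IH)
             apply (simp_all add: d)[8]
     apply (simp, linarith)
    apply simp
    done
qed

lemma wpt_parse_relation:
  assumes "vars s ''n'' = n" "vars s ''i'' + length hs = n"
    and "stored (arrays s ''in'') (vars s ''t'') (concat (map enc_partition hs))"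
    and "vars s ''t'' + length (concat (map enc_partition hs)) < 2 ^ w"
    and "\<And>ls. ls \<in> set hs \<Longrightarrow> set (concat ls) \<subseteq> {..<n} \<and> distinct (concat ls) \<and> length ls \<le> n"
    and "140 * length (concat (map enc_partition hs)) + 10 + B \<le> N"
  shows "wpt w parse_relation (\<lambda>t M. B \<le> M \<and>
    vars t ''t'' = vars s ''t'' + length (concat (map enc_partition hs)) \<and>
    arrays t ''cls'' = set_relation n (vars s ''i'') hs (arrays s ''cls'')) s N"
  using assms
proof (induction hs arbitrary: s N)
  case Nil
  then show ?case
    unfolding parse_relation_def by (subst wpt_While_unfold) (simp add: fits_small)
next
  case (Cons ls hs)
  note p = Cons.prems
  have d: "\<Union> (set ` set ls) \<subseteq> {..<n}" "distinct (concat ls)" "length ls \<le> n"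
    using p(5)[of ls] by auto
  have f: "n < 2 ^ w" "vars s ''i'' < 2 ^ w" "Suc (vars s ''i'') < 2 ^ w" "length ls < 2 ^ w"
      "vars s ''t'' < 2 ^ w" "Suc (vars s ''t'') < 2 ^ w" "vars s ''i'' < n"
    using p(1-4) d by (simp_all add: fits_small enc_partition_def)
  show ?case
    unfolding parse_relation_def
    apply (subst wpt_While_unfold)
    apply (fold parse_relation_def)
    using p(1-4,6) f
    apply (simp add: enc_partition_def[of ls] del: One_nat_def)
    apply (intro conjI; (linarith)?)
    apply (rule wpt_use)
     apply (rule wpt_parse_partition[where ls = ls and
          B = "140 * length (concat (map enc_partition hs)) + 50 + B"])
             apply (simp_all add: d)[9]
    apply (simp add: parse_partition_def parse_class_def del: One_nat_def)
    apply (intro conjI; (linarith)?)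
    apply (rule wpt_mono)
     apply (rule Cons.IH)
          apply simp_all[4]
    subgoal for t M ls
      using p(5)[of ls] by simp
     apply (simp, linarith)
    apply simp
    done
qed

lemma wpt_parse_subset:
  assumes "vars s ''j'' + length l = vars s ''r''" "vars s ''r'' \<le> n"
    and "stored (arrays s ''in'') (vars s ''t'') l" "vars s ''t'' + length l < 2 ^ w"
    and "set l \<subseteq> {..<n}" "40 * length l + 10 + B \<le> N"
  shows "wpt w parse_subset (\<lambda>t M. B \<le> M \<and>
    arrays t ''side'' = set_class 0 1 l (arrays s ''side'')) s N"
  using assms
proof (induction l arbitrary: s N)
  case Nil
  then show ?case
    unfolding parse_subset_def by (subst wpt_While_unfold) (simp add: fits_small)
next
  case (Cons x l)
  note p = Cons.prems
  have [simp]: "x < 2 ^ w"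
    using p fits_small[of x] by auto
  have f: "vars s ''j'' < 2 ^ w" "vars s ''r'' < 2 ^ w"
      "Suc (vars s ''j'') < 2 ^ w" "vars s ''t'' < 2 ^ w" "Suc (vars s ''t'') < 2 ^ w"
    using p by (simp_all add: fits_small)
  show ?case
    unfolding parse_subset_def
    apply (subst wpt_While_unfold)
    apply (fold parse_subset_def)
    using p f
    apply (simp del: One_nat_def)
    apply (intro conjI; (linarith)?)
    apply (rule wpt_mono)
     apply (rule Cons.IH)
          apply (simp_all add: fun_upd_def)
    done
qed

end

section \<open>The initial parts and the inheritance of flags\<close>

lemma row_upd_other:
  "(\<And>i. i < k \<Longrightarrow> a \<noteq> c * n + i) \<Longrightarrow> row n (f(a := x)) c k = row n f c k"
  by (rule row_cong) (auto simp: fun_upd_def)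

text \<open>Writing the supply as \<open>M' + K\<close> removes truncated subtraction: the
  simplifier can subtract the numeral costs of one iteration from \<open>K\<close> and never has to
  reason about \<open>M - K\<close>.\<close>

lemma credit_step:
  fixes x n :: nat
  assumes "x < n" "K * (n - x) + b + B \<le> M"
  obtains M' where "M = M' + K" "K * (n - Suc x) + b + B \<le> M'"
proof -
  have "n - x = Suc (n - Suc x)" using assms(1) by simp
  then have "K * (n - x) = K * (n - Suc x) + K" by simp
  then show ?thesis using that[of "M - K"] assms(2) by linarith
qed

context machine
begin

lemma fits_one_minus [simp]: "Suc 0 - k < 2 ^ w"
  by (rule le_less_trans[OF _ fits_one]) simp

lemma wpt_init_parts:
  assumes "vars s ''n'' = n" "vars s ''u'' = 0" "vars s ''r'' \<le> n"
    and "\<And>x. x < n \<Longrightarrow> arrays s ''side'' x \<le> 1"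
    and "arrays s ''size'' 0 = 0" "arrays s ''size'' (Suc 0) = 0"
    and "100 * n + 10 + B \<le> N"
  defines "g \<equiv> \<lambda>x. (1 - arrays s ''side'' x) * (1 - (1 - vars s ''r''))"
  shows "wpt w init_parts (\<lambda>t M. B \<le> M \<and> (\<forall>x<n. arrays t ''part'' x = g x) \<and>
    (\<forall>c\<le>1. arrays t ''size'' c = length (filter (\<lambda>x. g x = c) [0..<n]) \<and>
      row n (arrays t ''mem'') c (arrays t ''size'' c) = filter (\<lambda>x. g x = c) [0..<n])) s N"
proof -
  define I :: "state \<Rightarrow> nat \<Rightarrow> bool" where "I = (\<lambda>t M. vars t ''u'' \<le> n \<and> 100 * (n - vars t ''u'') + 10 + B \<le> M \<and>
    (\<forall>x<vars t ''u''. arrays t ''part'' x = g x) \<and>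
    (\<forall>c\<le>1. arrays t ''size'' c = length (filter (\<lambda>x. g x = c) [0..<vars t ''u'']) \<and>
      row n (arrays t ''mem'') c (arrays t ''size'' c) =
        filter (\<lambda>x. g x = c) [0..<vars t ''u'']))"
  have "I s N"
    using assms(1-7) by (auto simp: I_def le_Suc_eq)
  then show ?thesis
    unfolding init_parts_def
  proof (rule wpt_While_frame, goal_cases)
    case (1 t M)
    note [simp] = 1(2,3)
    define u where "u = vars t ''u''"
    have I: "vars t ''u'' = u" "u \<le> n" "100 * (n - u) + 10 + B \<le> M"
      "\<forall>x<u. arrays t ''part'' x = g x"
      "\<And>c. c \<le> 1 \<Longrightarrow> arrays t ''size'' c = length (filter (\<lambda>x. g x = c) [0..<u])"
      "\<And>c. c \<le> 1 \<Longrightarrow> row n (arrays t ''mem'') c (arrays t ''size'' c) =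
        filter (\<lambda>x. g x = c) [0..<u]"
      using 1(1) unfolding I_def u_def by blast+
    show ?case
    proof (cases "u < n")
      case False
      then have "u = n" using I by simp
      then show ?thesis using I assms(1) by (auto simp: fits_small)
    next
      case True
      have g: "g u \<le> 1" using assms(4)[of u] unfolding g_def by (cases "vars s ''r''") auto
      let ?z = "arrays t ''size'' (g u)"
      have z: "?z \<le> u"
        using I(5)[OF g] length_filter_le[of "\<lambda>x. g x = g u" "[0..<u]"] by simp
      have gu: "(1 - arrays s ''side'' u) * (1 - (1 - vars s ''r'')) = g u"
        by (simp add: g_def)
      have ext: "(if c = g u then Suc ?z else arrays t ''size'' c) =
          length (filter (\<lambda>x. g x = c) [0..<Suc u]) \<and>
        row n ((arrays t ''mem'')(g u * n + ?z := u)) c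
          (if c = g u then Suc ?z else arrays t ''size'' c) = filter (\<lambda>x. g x = c) [0..<Suc u]"
        if "c \<le> 1" for c
      proof (cases "c = g u")
        case True
        have "row n ((arrays t ''mem'')(g u * n + ?z := u)) c ?z = row n (arrays t ''mem'') c ?z"
          by (rule row_upd_other) (use True in simp)
        then show ?thesis using True I(5,6)[OF that] by (simp add: row_Suc)
      next
        case False
        have "arrays t ''size'' c \<le> u"
          using I(5)[OF that] length_filter_le[of "\<lambda>x. g x = c" "[0..<u]"] by simp
        then have "row n ((arrays t ''mem'')(g u * n + ?z := u)) c (arrays t ''size'' c) =
            row n (arrays t ''mem'') c (arrays t ''size'' c)"
          using z \<open>u < n\<close> False by (intro row_upd_other) simp
        then show ?thesis using False I(5,6)[OF that] by simp
      qed
      have ext1: "(if c = g u then Suc ?z else arrays t ''size'' c) =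
          length (filter (\<lambda>x. g x = c) [0..<Suc u])"
        and ext2: "row n ((arrays t ''mem'')(g u * n + ?z := u)) c
            (length (filter (\<lambda>x. g x = c) [0..<Suc u])) = filter (\<lambda>x. g x = c) [0..<Suc u]"
        if "c \<le> 1" for c
        using ext[OF that] by argo+
      have part: "\<forall>x<Suc u. (if x = u then g u else arrays t ''part'' x) = g x"
        using I(4) by (simp add: less_Suc_eq)
      have f: "n < 2 ^ w" "u < 2 ^ w" "Suc u < 2 ^ w" "?z < 2 ^ w" "Suc ?z < 2 ^ w"
        "g u < 2 ^ w" "g u * n + ?z < 2 ^ w" "g u * n < 2 ^ w" "vars s ''r'' < 2 ^ w"
        "arrays s ''side'' u < 2 ^ w"
        using z g assms(3) assms(4)[of u] True by (simp_all add: fits_small fits_address)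
      obtain M' where M: "M = M' + 100" "100 * (n - Suc u) + 10 + B \<le> M'"
        using credit_step[OF True I(3)] .
      show ?thesis
        using True f assms(1) I(1) unfolding M
        apply (simp add: gu del: One_nat_def)
        apply (simp add: I_def gu del: upt_Suc split del: if_split)
        using ext1 ext2 part M(2)
        apply (simp del: upt_Suc split del: if_split)
        done
    qed
  qed
qed

lemma wpt_copy_done:
  assumes "vars s ''n'' = n" "vars s ''x'' = 0" "vars s ''c'' < n" "vars s ''m'' \<le> n"
    and "\<And>x. x < n \<Longrightarrow> arrays s ''done'' (vars s ''c'' * n + x) \<le> 1"
    and "vars s ''c'' \<noteq> vars s ''m''" "40 * n + 10 + B \<le> N"
  shows "wpt w copy_done (\<lambda>t M. B \<le> M \<and>
     (\<forall>x<n. arrays t ''done'' (vars s ''m'' * n + x) = arrays s ''done'' (vars s ''c'' * n + x)) \<and>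
     (\<forall>d x. d \<noteq> vars s ''m'' \<longrightarrow> x < n \<longrightarrow>
        arrays t ''done'' (d * n + x) = arrays s ''done'' (d * n + x))) s N"
proof -
  define I :: "state \<Rightarrow> nat \<Rightarrow> bool" where "I = (\<lambda>t M. vars t ''x'' \<le> n \<and> 40 * (n - vars t ''x'') + 10 + B \<le> M \<and>
     (\<forall>x<vars t ''x''. arrays t ''done'' (vars s ''m'' * n + x) =
        arrays s ''done'' (vars s ''c'' * n + x)) \<and>
     (\<forall>d x. d \<noteq> vars s ''m'' \<longrightarrow> x < n \<longrightarrow>
        arrays t ''done'' (d * n + x) = arrays s ''done'' (d * n + x)))"
  have "I s N"
    using assms by (auto simp: I_def)
  then show ?thesis
    unfolding copy_done_def
  proof (rule wpt_While_frame, goal_cases)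
    case (1 t M)
    note [simp] = 1(2,3)
    define x where "x = vars t ''x''"
    have I: "vars t ''x'' = x" "x \<le> n" "40 * (n - x) + 10 + B \<le> M"
      "\<forall>x'<x. arrays t ''done'' (vars s ''m'' * n + x') = arrays s ''done'' (vars s ''c'' * n + x')"
      "\<forall>d x. d \<noteq> vars s ''m'' \<longrightarrow> x < n \<longrightarrow>
        arrays t ''done'' (d * n + x) = arrays s ''done'' (d * n + x)"
      using 1(1) unfolding I_def x_def by blast+
    show ?case
    proof (cases "x < n")
      case False
      then have "x = n" using I by simp
      then show ?thesis using I assms(1) by (auto simp: fits_small)
    next
      case True
      have f: "n < 2 ^ w" "x < 2 ^ w" "Suc x < 2 ^ w" "vars s ''c'' < 2 ^ w" "vars s ''m'' < 2 ^ w"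
        "vars s ''c'' * n < 2 ^ w" "vars s ''m'' * n < 2 ^ w"
        "vars s ''c'' * n + x < 2 ^ w" "vars s ''m'' * n + x < 2 ^ w"
        "arrays t ''done'' (vars s ''c'' * n + x) < 2 ^ w"
        using assms(3,4,6) I(5) True assms(5)[of x]
        by (simp_all add: fits_small fits_address)
      obtain M' where M: "M = M' + 40" "40 * (n - Suc x) + 10 + B \<le> M'"
        using credit_step[OF True I(3)] .
      show ?thesis
        using True f assms(1) I(1) unfolding M
        apply (simp del: One_nat_def)
        using I(4,5) M(2) assms(6)
        apply (auto simp: I_def less_Suc_eq)
        done
    qed
  qed
qed

end

section \<open>Writing the output\<close>

primrec store :: "nat \<Rightarrow> nat list \<Rightarrow> (nat \<Rightarrow> nat) \<Rightarrow> nat \<Rightarrow> nat" where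
  "store t [] f = f"
| "store t (x # l) f = store (Suc t) l (f(t := x))"

lemma store_less: "a < t \<Longrightarrow> store t l f a = f a"
  by (induction l arbitrary: t f) simp_all

lemma stored_store: "stored (store t l f) t l"
  by (induction l arbitrary: t f) (simp_all add: store_less)

lemma store_append: "store t (l @ l') f = store (t + length l) l' (store t l f)"
  by (induction l arbitrary: t f) simp_all

lemma stored_row: "stored f (c * n) (row n f c k)"
  by (simp add: stored_def)

context machine
begin

lemma wpt_write_part:
  assumes "vars s ''n'' = n" "vars s ''c'' \<le> n"
    and "vars s ''i'' + length l = arrays s ''size'' (vars s ''c'')"
    and "arrays s ''size'' (vars s ''c'') \<le> n"
    and "stored (arrays s ''mem'') (vars s ''c'' * n + vars s ''i'') l"
    and "vars s ''t'' + length l < 2 ^ w" "set l \<subseteq> {..<n}" "40 * length l + 10 + B \<le> N"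
  shows "wpt w write_part (\<lambda>t M. B \<le> M \<and> vars t ''t'' = vars s ''t'' + length l \<and>
    arrays t ''out'' = store (vars s ''t'') l (arrays s ''out'')) s N"
  using assms
proof (induction l arbitrary: s N)
  case Nil
  then show ?case
    unfolding write_part_def by (subst wpt_While_unfold) (simp add: fits_small)
next
  case (Cons x l)
  note p = Cons.prems
  have [simp]: "x < 2 ^ w"
    using p fits_small[of x] by auto
  have f: "vars s ''i'' < 2 ^ w" "Suc (vars s ''i'') < 2 ^ w" "vars s ''c'' < 2 ^ w"
    "arrays s ''size'' (vars s ''c'') < 2 ^ w" "n < 2 ^ w"
    "vars s ''c'' * n < 2 ^ w" "vars s ''c'' * n + vars s ''i'' < 2 ^ w"
    "vars s ''t'' < 2 ^ w" "Suc (vars s ''t'') < 2 ^ w"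
    using p by (simp_all add: fits_small fits_address)
  show ?case
    unfolding write_part_def
    apply (subst wpt_While_unfold)
    apply (fold write_part_def)
    using p f
    apply (simp del: One_nat_def)
    apply (intro conjI; (linarith)?)
    apply (rule wpt_mono)
     apply (rule Cons.IH)
            apply (simp_all add: fun_upd_def)
    done
qed

lemma wpt_write_parts:
  assumes "vars s ''n'' = n" "vars s ''c'' + length ls = vars s ''m''" "vars s ''m'' \<le> n"
    and "\<And>k. k < length ls \<Longrightarrow> arrays s ''size'' (vars s ''c'' + k) = length (ls ! k) \<and>
      length (ls ! k) \<le> n \<and> set (ls ! k) \<subseteq> {..<n} \<and>
      stored (arrays s ''mem'') ((vars s ''c'' + k) * n) (ls ! k)"
    and "vars s ''t'' + length (concat (map enc_set ls)) < 2 ^ w"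
    and "100 * length (concat (map enc_set ls)) + 10 + B \<le> N"
  shows "wpt w write_parts (\<lambda>t M. B \<le> M \<and>
    arrays t ''out'' = store (vars s ''t'') (concat (map enc_set ls)) (arrays s ''out'')) s N"
  using assms
proof (induction ls arbitrary: s N)
  case Nil
  then show ?case
    unfolding write_parts_def by (subst wpt_While_unfold) (simp add: fits_small)
next
  case (Cons l ls)
  note p = Cons.prems
  have l: "arrays s ''size'' (vars s ''c'') = length l" "length l \<le> n" "set l \<subseteq> {..<n}"
    "stored (arrays s ''mem'') (vars s ''c'' * n) l"
    using p(4)[of 0] by auto
  have ls: "arrays s ''size'' (Suc (vars s ''c'' + k)) = length (ls ! k) \<and>
      length (ls ! k) \<le> n \<and> set (ls ! k) \<subseteq> {..<n} \<and>
      stored (arrays s ''mem'') (n + (vars s ''c'' + k) * n) (ls ! k)" if "k < length ls" for k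
    using p(4)[of "Suc k"] that by simp
  have f: "n < 2 ^ w" "vars s ''c'' < 2 ^ w" "vars s ''m'' < 2 ^ w" "Suc (vars s ''c'') < 2 ^ w"
      "vars s ''t'' < 2 ^ w" "Suc (vars s ''t'') < 2 ^ w" "length l < 2 ^ w"
    using p(1,2,3,5) l(2) by (simp_all add: fits_small enc_set_def)
  show ?case
    unfolding write_parts_def
    apply (subst wpt_While_unfold)
    apply (fold write_parts_def)
    using p(1-3,5,6) f l(1,2)
    apply (simp add: enc_set_def[of l] del: One_nat_def)
    apply (intro conjI; (linarith)?)
    apply (rule wpt_use)
     apply (rule wpt_write_part[where l = l and
          B = "100 * length (concat (map enc_set ls)) + 50 + B"])
             apply (simp_all add: l)[8]
    apply (simp add: write_part_def del: One_nat_def)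
    apply (intro conjI; (linarith)?)
    apply (rule wpt_mono)
     apply (rule Cons.IH)
          apply (simp_all add: ls)[5]
     apply (simp, linarith)
    apply (simp add: store_append fun_upd_def)
    done
qed

end

section \<open>Running the refinement\<close>

locale refinement = umodule_instance X H S xs cls n + machine w n
  for X :: "'a set" and H S xs cls n w
begin

text \<open>One iteration of \<open>separate\<close> has exactly this effect, so its invariant can
  describe \<open>rep\<close> by \<open>new_rep\<close> applied to the processed prefix.\<close>

lemma new_rep_insert:
  "new_rep rep (insert u T) y = (let a = u * n + cls (u * n + y); r = new_rep rep T y
     in if r a = 0 then r(a := Suc y) else r)"
  by (auto simp: new_rep_def Let_def fun_eq_iff)

text \<open>\<open>keep\<close> speaks of the labels after all of \<open>cs\<close> has been
  treated. It can already be decided when \<open>u\<close> is reached, because the label of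
  \<open>u\<close> at \<open>y\<close> depends on the slot of \<open>u\<close> alone.\<close>

lemma wpt_separate:
  assumes v: "vars s ''n'' = n" "vars s ''c'' = c" "vars s ''m'' = m" "vars s ''y'' = y"
      "vars s ''l'' = L" "vars s ''i'' = 0" "vars s ''j'' = 0" "vars s ''h'' = 0"
    and a: "arrays s ''cls'' = cls" "arrays s ''rep'' = rep" "arrays s ''size'' c = z"
      "arrays s ''mem'' = mem" "arrays s ''part'' = part"
    and cs: "row n mem c z = cs" "set cs \<subseteq> {..<n}" "y < n" "y \<notin> set cs" "z \<le> n"
    and m: "c < m" "m \<le> n" and rep: "rep_inv rep" and L: "L \<le> n"
    and N: "200 * z + 10 + B \<le> N"
  defines "keep \<equiv> \<lambda>u. label (new_rep rep (set cs) y) u y = L"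
  shows "wpt w separate (\<lambda>t M. B \<le> M \<and>
    vars t ''j'' = length (filter keep cs) \<and> vars t ''h'' = length (filter (\<lambda>u. \<not> keep u) cs) \<and>
    arrays t ''rep'' = new_rep rep (set cs) y \<and>
    row n (arrays t ''mem'') c (vars t ''j'') = filter keep cs \<and>
    row n (arrays t ''mem'') m (vars t ''h'') = filter (\<lambda>u. \<not> keep u) cs \<and>
    (\<forall>d<m. d \<noteq> c \<longrightarrow> (\<forall>k<n. arrays t ''mem'' (d * n + k) = mem (d * n + k))) \<and>
    (\<forall>u. arrays t ''part'' u = (if u \<in> set cs \<and> \<not> keep u then m else part u))) s N"
proof -
  define I :: "state \<Rightarrow> nat \<Rightarrow> bool" where "I = (\<lambda>t M. vars t ''i'' \<le> z \<and>
    200 * (z - vars t ''i'') + 10 + B \<le> M \<and>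
    vars t ''j'' = length (filter keep (take (vars t ''i'') cs)) \<and>
    vars t ''h'' = length (filter (\<lambda>u. \<not> keep u) (take (vars t ''i'') cs)) \<and>
    arrays t ''rep'' = new_rep rep (set (take (vars t ''i'') cs)) y \<and>
    row n (arrays t ''mem'') c (vars t ''j'') = filter keep (take (vars t ''i'') cs) \<and>
    row n (arrays t ''mem'') m (vars t ''h'') = filter (\<lambda>u. \<not> keep u) (take (vars t ''i'') cs) \<and>
    (\<forall>k<z. vars t ''i'' \<le> k \<longrightarrow> arrays t ''mem'' (c * n + k) = cs ! k) \<and>
    (\<forall>d<m. d \<noteq> c \<longrightarrow> (\<forall>k<n. arrays t ''mem'' (d * n + k) = mem (d * n + k))) \<and>
    (\<forall>u. arrays t ''part'' u =
      (if u \<in> set (take (vars t ''i'') cs) \<and> \<not> keep u then m else part u)))"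
  have len: "length cs = z" using cs(1) by auto
  have "new_rep rep {} y = rep" by (simp add: new_rep_def fun_eq_iff)
  then have "I s N"
    using v a N cs(1) by (auto simp: I_def)
  then show ?thesis
    unfolding separate_def
  proof (rule wpt_While_frame, goal_cases)
    case (1 t M)
    note [simp] = 1(2,3)
    define i where "i = vars t ''i''"
    define T where "T = take i cs"
    define j where "j = vars t ''j''"
    define h where "h = vars t ''h''"
    have I: "vars t ''i'' = i" "i \<le> z" "200 * (z - i) + 10 + B \<le> M"
      "vars t ''j'' = j" "vars t ''h'' = h" "arrays t ''rep'' = new_rep rep (set T) y"
      "row n (arrays t ''mem'') c j = filter keep T"
      "row n (arrays t ''mem'') m h = filter (\<lambda>u. \<not> keep u) T"
      "\<forall>k<z. i \<le> k \<longrightarrow> arrays t ''mem'' (c * n + k) = cs ! k"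
      "\<forall>d<m. d \<noteq> c \<longrightarrow> (\<forall>k<n. arrays t ''mem'' (d * n + k) = mem (d * n + k))"
      "\<forall>u. arrays t ''part'' u = (if u \<in> set T \<and> \<not> keep u then m else part u)"
      and jh: "j = length (filter keep T)" "h = length (filter (\<lambda>u. \<not> keep u) T)"
      using 1(1) unfolding I_def i_def T_def j_def h_def by blast+
    show ?case
    proof (cases "i < z")
      case False
      then have "i = z" "T = cs" using I len unfolding T_def by auto
      then show ?thesis using I v a cs(5) m by (auto simp: fits_small jh)
    next
      case True
      define u where "u = cs ! i"
      define r where "r = new_rep rep (set T) y"
      define a where "a = u * n + cls (u * n + y)"
      define r' where "r' = (if r a = 0 then r(a := Suc y) else r)"
      have u: "u \<in> set cs" using True len unfolding u_def by auto
      then have un: "u < n" "u \<noteq> y" using cs by auto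
      have T': "take (Suc i) cs = T @ [u]"
        using True len unfolding T_def u_def by (simp add: take_Suc_conv_app_nth)
      have r': "new_rep rep (insert u (set T)) y = r'"
        unfolding r'_def r_def a_def by (simp add: new_rep_insert Let_def)
      have keep: "keep u \<longleftrightarrow> r' a = L"
        using new_rep_label[OF u, of rep y] new_rep_label[of u "insert u (set T)" rep y]
        unfolding keep_def r'[symmetric] a_def by simp
      \<comment> \<open>The write position \<open>j\<close> never passes the read position
        \<open>i\<close>, so compaction destroys no unread entry. Since \<open>i < n\<close>,
        neither row can run into the next one.\<close>
      have jhi: "j \<le> i" "h \<le> i" "i < n"
        using len True cs(5) length_filter_le[of keep T] length_filter_le[of "\<lambda>u. \<not> keep u" T]
        unfolding jh T_def by auto
      have "set T \<subseteq> set cs" unfolding T_def by (rule set_take_subset)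
      then have r: "rep_inv r"
        unfolding r_def using rep cs by (intro rep_inv_new_rep) auto
      have cls: "cls (u * n + y) < n" using un cs by (intro cls_less) auto
      have ra: "r a \<le> n"
      proof (cases "r a")
        case (Suc q)
        then have "q < n" using r un cls unfolding rep_inv_def a_def by blast
        then show ?thesis using Suc by simp
      qed simp
      obtain M' where M: "M = M' + 200" "200 * (z - Suc i) + 10 + B \<le> M'"
        using credit_step[OF True I(3)] .
      have f: "n < 2 ^ w" "i < 2 ^ w" "Suc i < 2 ^ w" "j < 2 ^ w" "Suc j < 2 ^ w" "h < 2 ^ w"
        "Suc h < 2 ^ w" "c < 2 ^ w" "m < 2 ^ w" "y < 2 ^ w" "Suc y < 2 ^ w" "u < 2 ^ w"
        "z < 2 ^ w" "L < 2 ^ w" "cls (u * n + y) < 2 ^ w" "r a < 2 ^ w"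
        "u * n < 2 ^ w" "u * n + y < 2 ^ w" "a < 2 ^ w" "c * n < 2 ^ w" "c * n + i < 2 ^ w"
        "c * n + j < 2 ^ w" "m * n < 2 ^ w" "m * n + h < 2 ^ w"
        using True jhi cs(3,5) un cls ra m L by (simp_all add: fits_small fits_address a_def)
      have mu: "arrays t ''mem'' (c * n + i) = u"
        using I(9) True unfolding u_def by blast
      let ?k = "(arrays t ''mem'')(c * n + j := u)"
      let ?m = "(arrays t ''mem'')(m * n + h := u)"
      have rows_c: "row n ?k c j = filter keep T" "row n ?m c j = filter keep T"
        using I(7) jhi m by (simp_all add: row_upd_other)
      have rows_m: "row n ?k m h = filter (\<lambda>u. \<not> keep u) T" "row n ?m m h = filter (\<lambda>u. \<not> keep u) T"
        using I(8) jhi m by (simp_all add: row_upd_other)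
      have rest: "\<forall>k<z. Suc i \<le> k \<longrightarrow> ?k (c * n + k) = cs ! k"
          "\<forall>k<z. Suc i \<le> k \<longrightarrow> ?m (c * n + k) = cs ! k"
        using I(9) jhi m cs(5) by simp_all
      have other: "\<forall>d<m. d \<noteq> c \<longrightarrow> (\<forall>k<n. ?k (d * n + k) = mem (d * n + k))"
          "\<forall>d<m. d \<noteq> c \<longrightarrow> (\<forall>k<n. ?m (d * n + k) = mem (d * n + k))"
        using I(10) jhi m by simp_all
      have part_keep: "\<forall>v. (if v \<in> set T \<and> \<not> keep v then m else part v) =
          (if (v = u \<or> v \<in> set T) \<and> \<not> keep v then m else part v)" if "keep u"
        using that by auto
      have part_move: "\<forall>v. (if v = u then m else arrays t ''part'' v) =
          (if (v = u \<or> v \<in> set T) \<and> \<not> keep v then m else part v)" if "\<not> keep u"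
        using that I(11) by simp
      \<comment> \<open>The cases are the four paths through the two conditionals. The second test
        reads the slot after it may have been filled, hence \<open>r'\<close> and not
        \<open>r\<close>.\<close>
      show ?thesis
      proof (cases "r a = 0"; cases "r' a = L")
        assume 1: "r a = 0" "r' a = L"
        then have 2: "y + 1 = L" "keep u" "r' = r(a := Suc y)"
          using keep by (simp_all add: r'_def)
        show ?thesis
          unfolding M
          using f I(1-6) v mu a(1,3) True a_def[symmetric] r_def[symmetric] 1(1) 2(1)
          apply (simp del: One_nat_def split del: if_split)
          using M(2) r' 2(2,3) I(10,11) jh rows_c rows_m rest other mu
          apply (simp add: I_def T' row_Suc split del: if_split)
          apply (rule part_keep[OF 2(2)])
          done
      next
        assume 1: "r a = 0" "r' a \<noteq> L"
        then have 2: "y + 1 \<noteq> L" "\<not> keep u" "r' = r(a := Suc y)"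
          using keep by (simp_all add: r'_def)
        show ?thesis
          unfolding M
          using f I(1-6) v mu a(1,3) True a_def[symmetric] r_def[symmetric] 1(1) 2(1)
          apply (simp del: One_nat_def split del: if_split)
          using M(2) r' 2(2,3) I(10,11) jh rows_c rows_m rest other mu
          apply (simp add: I_def T' row_Suc split del: if_split)
          apply (rule part_move[OF 2(2)])
          done
      next
        assume 1: "r a \<noteq> 0" "r' a = L"
        then have 2: "r a = L" "keep u" "r' = r"
          using keep by (simp_all add: r'_def)
        show ?thesis
          unfolding M
          using f I(1-6) v mu a(1,3) True a_def[symmetric] r_def[symmetric] 1(1) 2(1)
          apply (simp del: One_nat_def split del: if_split)
          using M(2) r' 2(2,3) I(10,11) jh rows_c rows_m rest other mu
          apply (simp add: I_def T' row_Suc split del: if_split)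
          apply (rule part_keep[OF 2(2)])
          done
      next
        assume 1: "r a \<noteq> 0" "r' a \<noteq> L"
        then have 2: "r a \<noteq> L" "\<not> keep u" "r' = r"
          using keep by (simp_all add: r'_def)
        show ?thesis
          unfolding M
          using f I(1-6) v mu a(1,3) True a_def[symmetric] r_def[symmetric] 1(1) 2(1)
          apply (simp del: One_nat_def split del: if_split)
          using M(2) r' 2(2,3) I(10,11) jh rows_c rows_m rest other mu
          apply (simp add: I_def T' row_Suc split del: if_split)
          apply (rule part_move[OF 2(2)])
          done
      qed
    qed
  qed
qed

end

section \<open>The number of unsettled pairs and the potential\<close>

context umodule_instance
begin

text \<open>Reading the flag through the part of \<open>u\<close> makes one flag of a part count as
  many pairs as the part has members, and leaves the number unchanged by a split with copied flags.
  Pairs inside one part are counted as well; they remain unsettled while they are together.\<close>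

definition undone :: "(nat \<Rightarrow> nat) \<Rightarrow> (nat \<Rightarrow> nat) \<Rightarrow> nat" where
  "undone part dn = card {(u, x). u < n \<and> x < n \<and> dn (part u * n + x) = 0}"

lemma undone_le: "undone part dn \<le> n * n"
proof -
  have "undone part dn \<le> card ({..<n} \<times> {..<n})"
    unfolding undone_def by (intro card_mono) auto
  then show ?thesis by (simp add: card_cartesian_product)
qed

lemma undone_upd:
  assumes "c < m" "y < n" "dn (c * n + y) = 0" "\<forall>u<n. part u < m"
    and "C = {u. u < n \<and> part u = c}"
  shows "undone part (dn(c * n + y := Suc 0)) + card C = undone part dn"
proof -
  let ?U = "\<lambda>dn. {(u, x). u < n \<and> x < n \<and> dn (part u * n + x) = 0}"
  have "?U dn = ?U (dn(c * n + y := Suc 0)) \<union> (\<lambda>u. (u, y)) ` C"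
    using assms(2,3,5) by auto
  moreover have "?U (dn(c * n + y := Suc 0)) \<inter> (\<lambda>u. (u, y)) ` C = {}"
    using assms(5) by auto
  moreover have "finite (?U (dn(c * n + y := Suc 0)))"
    by (rule finite_subset[of _ "{..<n} \<times> {..<n}"]) auto
  moreover have "finite C" using assms(5) by simp
  moreover have "card ((\<lambda>u. (u, y)) ` C) = card C"
    by (intro card_image inj_onI) simp
  ultimately show ?thesis
    unfolding undone_def by (simp add: card_Un_disjoint)
qed

lemma undone_split:
  assumes "\<And>u. u < n \<Longrightarrow> part' u = part u \<or> part' u = m \<and> part u = c"
    and "\<And>u. u < n \<Longrightarrow> part u < m"
    and "\<And>d z. d < m \<Longrightarrow> z < n \<Longrightarrow> dn' (d * n + z) = dn (d * n + z)"
    and "\<And>z. z < n \<Longrightarrow> dn' (m * n + z) = dn (c * n + z)"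
  shows "undone part' dn' = undone part dn"
proof -
  have "dn' (part' u * n + x) = dn (part u * n + x)" if "u < n" "x < n" for u x
    using assms(1)[OF that(1)] assms(2)[OF that(1)] assms(3,4) that(2) by auto
  then have "{(u, x). u < n \<and> x < n \<and> dn' (part' u * n + x) = 0} =
      {(u, x). u < n \<and> x < n \<and> dn (part u * n + x) = 0}"
    by auto
  then show ?thesis unfolding undone_def by (rule arg_cong)
qed

text \<open>The specification of \<open>separate\<close> describes \<open>mem\<close> only on the
  rows in use. Without a split, agreement of the array with the old one is thus known on these rows
  only.\<close>

lemma refine_inv_mem_cong:
  assumes "refine_inv part m mem sz rep dn c y"
    and "\<And>d. d < m \<Longrightarrow> row n mem' d (sz d) = row n mem d (sz d)"
  shows "refine_inv part m mem' sz rep dn c y"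
proof -
  have "\<forall>d<m. 0 < sz d \<and> distinct (row n mem d (sz d)) \<and>
      set (row n mem d (sz d)) = {u. u < n \<and> part u = d}"
    using assms(1) unfolding refine_inv_def parts_inv_def by blast
  then have "\<forall>d<m. 0 < sz d \<and> distinct (row n mem' d (sz d)) \<and>
      set (row n mem' d (sz d)) = {u. u < n \<and> part u = d}"
    by (simp add: assms(2))
  then show ?thesis
    using assms(1) unfolding refine_inv_def parts_inv_def by blast
qed

text \<open>
  The \<open>U\<close> unsettled pairs pay for the comparisons without a split, the \<open>n - m\<close> parts that can still
  be created for those with a split, and the last two terms for the moves to the next element and
  to the next part.
\<close>

definition potential :: "nat \<Rightarrow> nat \<Rightarrow> nat \<Rightarrow> nat \<Rightarrow> nat" where
  "potential U m c y =
     400 * U + (300 * n + 400) * (n - m) + 60 * (n - y) + (60 * n + 60) * (n - c)"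

end

context refinement
begin

definition refining :: "state \<Rightarrow> bool" where
  "refining t \<longleftrightarrow> vars t ''n'' = n \<and> arrays t ''cls'' = cls \<and>
     refine_inv (arrays t ''part'') (vars t ''m'') (arrays t ''mem'') (arrays t ''size'')
       (arrays t ''rep'') (arrays t ''done'') (vars t ''c'') (vars t ''y'')"

definition credits :: "state \<Rightarrow> nat" where
  "credits t = potential (undone (arrays t ''part'') (arrays t ''done''))
     (vars t ''m'') (vars t ''c'') (vars t ''y'')"

text \<open>The supply may fall short of the potential by 40, because \<open>refine\<close> has
  already paid for its tests; the drop of the potential makes up for the deficit.\<close>

lemma wpt_process:
  assumes ref: "refining s" and cm: "vars s ''c'' < vars s ''m''" and yn: "vars s ''y'' < n"
    and yc: "arrays s ''part'' (vars s ''y'') \<noteq> vars s ''c''"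
    and dn0: "arrays s ''done'' (vars s ''c'' * n + vars s ''y'') = 0"
    and N: "credits s + B \<le> N + 40"
  shows "wpt w process (\<lambda>t M. refining t \<and> credits t + B \<le> M) s N"
proof -
  define c where "c = vars s ''c''"
  define y where "y = vars s ''y''"
  define m where "m = vars s ''m''"
  define part where "part = arrays s ''part''"
  define mem where "mem = arrays s ''mem''"
  define sz where "sz = arrays s ''size''"
  define rep where "rep = arrays s ''rep''"
  define dn where "dn = arrays s ''done''"
  note defs = c_def y_def m_def part_def mem_def sz_def rep_def dn_def
  have inv: "refine_inv part m mem sz rep dn c y"
    and s: "vars s ''n'' = n" "arrays s ''cls'' = cls"
    using ref unfolding refining_def defs by auto
  have h: "c < m" "y < n" "part y \<noteq> c" "dn (c * n + y) = 0"
    using cm yn yc dn0 unfolding defs by auto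
  have i: "parts_inv part m mem sz" "rep_inv rep" "done_inv part m rep dn"
    using inv unfolding refine_inv_def by auto
  have mn: "m \<le> n" by (rule parts_le[OF i(1)])
  define C where "C = {u. u < n \<and> part u = c}"
  define z where "z = sz c"
  define cs where "cs = row n mem c z"
  have cs: "distinct cs" "set cs = C" "0 < z" "z \<le> n"
    using i(1) h(1) size_le[OF i(1)] unfolding parts_inv_def C_def cs_def z_def by auto
  have card: "card C = z"
    using distinct_card[OF cs(1)] cs(2) unfolding cs_def by simp
  define u where "u = cs ! 0"
  have u: "u = mem (c * n)" "u \<in> C" "u < n" "u \<noteq> y"
  proof -
    show "u \<in> C"
      using cs nth_mem[of 0 cs] unfolding u_def cs_def by simp
    then show "u < n" "u \<noteq> y" using h unfolding C_def by auto
    show "u = mem (c * n)" using cs(3) unfolding u_def cs_def by simp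
  qed
  define a where "a = u * n + cls (u * n + y)"
  \<comment> \<open>This is the label of the first member after its slot is filled. As this member
    satisfies \<open>keep\<close>, the reduced part \<open>c\<close> is nonempty.\<close>
  define L where "L = (if rep a = 0 then Suc y else rep a)"
  have L: "label (new_rep rep C y) u y = L"
    using new_rep_label[OF u(2)] unfolding L_def a_def by simp
  define keep where "keep = (\<lambda>v. label (new_rep rep C y) v y = L)"
  have keep_iff: "keep v \<longleftrightarrow> label (new_rep rep C y) v y = L" for v
    by (simp add: keep_def)
  have "cls (u * n + y) < n" using u h by (intro cls_less) auto
  have ra: "rep a \<le> n"
  proof (cases "rep a")
    case (Suc q)
    then have "q < n" using i(2) u \<open>cls _ < n\<close> unfolding rep_inv_def a_def by blast
    then show ?thesis using Suc by simp
  qed simp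
  have Ln: "L \<le> n" using ra h unfolding L_def by simp
  have yC: "y \<notin> C" "C \<subseteq> {..<n}" using h unfolding C_def by auto
  have dn1: "dn (c * n + x) \<le> 1" if "x < n" for x
    using i(3) h(1) that unfolding done_inv_def by blast
  let ?tail = "block [Cond (Equal (Var ''h'') (Const 0))
        (block [Write ''done'' (index ''c'' (Var ''y'')) (Const 1), incr ''y''])
        (block [Write ''size'' (Var ''c'') (Var ''j''), Write ''size'' (Var ''m'') (Var ''h''),
                Assign ''x'' (Const 0), copy_done, incr ''m'', Assign ''y'' (Const 0)])]"
  \<comment> \<open>Both ways of setting \<open>l\<close> end in this code, so it is treated once.
    The amount \<open>200 * z + 190\<close> bounds what has been spent since the potential was last
    balanced.\<close>
  have tail: "wpt w ?tail (\<lambda>t M. refining t \<and> credits t + B \<le> M) t M"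
    if t: "vars t ''n'' = n" "vars t ''c'' = c" "vars t ''m'' = m" "vars t ''y'' = y"
        "arrays t ''cls'' = cls" "arrays t ''size'' = sz" "arrays t ''done'' = dn"
        "vars t ''j'' = length (filter keep cs)"
        "vars t ''h'' = length (filter (\<lambda>u. \<not> keep u) cs)"
        "arrays t ''rep'' = new_rep rep C y"
        "row n (arrays t ''mem'') c (vars t ''j'') = filter keep cs"
        "row n (arrays t ''mem'') m (vars t ''h'') = filter (\<lambda>u. \<not> keep u) cs"
        "\<forall>d<m. d \<noteq> c \<longrightarrow> (\<forall>k<n. arrays t ''mem'' (d * n + k) = mem (d * n + k))"
        "\<forall>u. arrays t ''part'' u = (if u \<in> C \<and> \<not> keep u then m else part u)"
      and M: "potential (undone part dn) m c y + B \<le> M + 200 * z + 190" for t M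
  proof (cases "vars t ''h'' = 0")
    case True
    then have keep: "keep v" if "v \<in> C" for v
      using t(9) that cs(2) by (auto simp: filter_empty_conv)
    then have "filter keep cs = cs" using cs(2) by (auto intro: filter_True)
    have [simp]: "arrays t ''part'' = part"
      using t(14) keep by (auto simp: fun_eq_iff)
    have mem': "row n (arrays t ''mem'') d (sz d) = row n mem d (sz d)" if "d < m" for d
    proof (cases "d = c")
      case True
      then show ?thesis using t(8,11) \<open>filter keep cs = cs\<close> unfolding cs_def z_def by simp
    next
      case False
      then show ?thesis
        using t(13) that size_le[OF i(1) that] by (intro row_cong) auto
    qed
    have "refine_inv part m mem sz (new_rep rep C y) (dn(c * n + y := 1)) c (Suc y)"
      using inv h C_def keep[unfolded keep_iff] by (rule step_no_split)
    then have *: "refine_inv part m (arrays t ''mem'') sz (new_rep rep C y)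
        (dn(c * n + y := Suc 0)) c (Suc y)"
      by (auto intro: refine_inv_mem_cong mem')
    \<comment> \<open>Settling \<open>z\<close> pairs and advancing \<open>y\<close> releases
      \<open>400 * z + 60\<close>. As \<open>z \<ge> 1\<close>, this covers the
      \<open>200 * z + 190\<close> already spent and 20 more for the rest of the branch.\<close>
    have "undone part (dn(c * n + y := Suc 0)) + z = undone part dn"
      using undone_upd[of c m y dn part C] h i(1) C_def card unfolding parts_inv_def by blast
    moreover have "n - y = Suc (n - Suc y)" using h by simp
    ultimately have pot: "potential (undone part (dn(c * n + y := Suc 0))) m c (Suc y) + B + 20 \<le> M"
      using M cs(3) unfolding potential_def by simp
    have f: "n < 2 ^ w" "c * n < 2 ^ w" "c * n + y < 2 ^ w" "c < 2 ^ w" "y < 2 ^ w" "Suc y < 2 ^ w"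
      using h mn by (simp_all add: fits_small fits_address)
    obtain M' where M': "M = M' + 20" using pot le_Suc_ex[of 20 M] by auto
    show ?thesis
      unfolding M'
      using f t(1-7,10) True
      apply (simp del: One_nat_def)
      using * pot M'
      apply (simp add: refining_def credits_def)
      done
  next
    case False
    let ?j = "length (filter keep cs)" and ?h = "length (filter (\<lambda>u. \<not> keep u) cs)"
    have split: "refine_inv (arrays t ''part'') (Suc m) (arrays t ''mem'') (sz(c := ?j, m := ?h))
        (new_rep rep C y) dn' c 0"
      if "\<And>d z. d < m \<Longrightarrow> z < n \<Longrightarrow> dn' (d * n + z) = dn (d * n + z)"
        "\<And>z. z < n \<Longrightarrow> dn' (m * n + z) = dn (c * n + z)" for dn'
      using inv h(1-3) C_def keep_iff
    proof (rule step_split)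
      show "\<exists>v\<in>C. keep v" using u(2) L unfolding keep_def by blast
      show "\<exists>v\<in>C. \<not> keep v"
        using False t(9) cs(2) by (auto simp: filter_empty_conv)
    qed (use t that in \<open>simp_all add: cs_def z_def\<close>)
    \<comment> \<open>The flags are not copied yet, so an explicit function with row
      \<open>c\<close> copied into row \<open>m\<close> stands in for the result. The invariant for
      it already yields \<open>Suc m \<le> n\<close>, which the word bounds and the potential need
      before \<open>copy_done\<close> runs.\<close>
    have "refine_inv (arrays t ''part'') (Suc m) (arrays t ''mem'') (sz(c := ?j, m := ?h))
        (new_rep rep C y) (\<lambda>b. if b div n = m then dn (c * n + b mod n) else dn b) c 0"
      by (rule split) (auto simp: div_add1_eq)
    then have mn': "Suc m \<le> n"
      unfolding refine_inv_def by (blast intro: parts_le)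
    \<comment> \<open>A new part releases \<open>300 * n + 400\<close>: at most
      \<open>200 * n\<close> for \<open>separate\<close>, \<open>60 * n\<close> for resetting
      \<open>y\<close>, \<open>40 * n\<close> for \<open>copy_done\<close>, and the constants 190
      and 200.\<close>
    then have "n - m = Suc (n - Suc m)" by simp
    then have "potential (undone part dn) (Suc m) c 0 + B + 40 * n + 200 \<le> M"
      using M cs(4) unfolding potential_def by simp
    then obtain M' where M': "M = M' + 40 * n + 200"
        "potential (undone part dn) (Suc m) c 0 + B \<le> M'"
      using le_Suc_ex[of "40 * n + 200" M] by auto
    have f: "n < 2 ^ w" "c < 2 ^ w" "m < 2 ^ w" "Suc m < 2 ^ w" "?j < 2 ^ w" "?h < 2 ^ w"
      using h mn' cs(4) length_filter_le[of keep cs] length_filter_le[of "\<lambda>u. \<not> keep u" cs]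
      by (simp_all add: fits_small cs_def)
    have lt: "\<forall>v<n. part v < m" using i(1) unfolding parts_inv_def by blast
    have undone: "undone (arrays t ''part'') dn' = undone part dn"
      if "\<And>d z. d < m \<Longrightarrow> z < n \<Longrightarrow> dn' (d * n + z) = dn (d * n + z)"
        "\<And>z. z < n \<Longrightarrow> dn' (m * n + z) = dn (c * n + z)" for dn'
      by (rule undone_split[where m = m and c = c]) (use lt t(14) that in \<open>auto simp: C_def\<close>)
    have fin: "refine_inv (arrays t ''part'') (Suc m) (arrays t ''mem'') (sz(c := ?j, m := ?h))
        (new_rep rep C y) dn' c 0 \<and>
        potential (undone (arrays t ''part'') dn') (Suc m) c 0 + B \<le> M'"
      if "\<forall>x<n. dn' (m * n + x) = dn (c * n + x)"
        "\<forall>d x. d \<noteq> m \<longrightarrow> x < n \<longrightarrow> dn' (d * n + x) = dn (d * n + x)" for dn'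
      using split[of dn'] undone[of dn'] that M'(2) by simp
    show ?thesis
      unfolding M'
      using f t(1-10) False
      apply (simp del: One_nat_def)
      apply (rule wpt_use)
       apply (rule wpt_copy_done[where B = "M' + 100"])
             apply (use h mn dn1 in simp_all)[7]
      subgoal for t2 M2
        using fin[of "arrays t2 ''done''"]
        apply (simp add: refining_def credits_def copy_done_def del: One_nat_def)
        apply simp
        apply (intro conjI; linarith)
        done
      done
  qed
  have f: "n < 2 ^ w" "c < 2 ^ w" "c * n < 2 ^ w" "y < 2 ^ w" "Suc y < 2 ^ w" "u < 2 ^ w"
    "u * n < 2 ^ w" "u * n + y < 2 ^ w" "cls (u * n + y) < 2 ^ w" "a < 2 ^ w" "rep a < 2 ^ w"
    using h mn u ra \<open>cls _ < n\<close> by (simp_all add: fits_small fits_address a_def)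
  have pot: "potential (undone part dn) m c y + B \<le> N + 40"
    using N unfolding credits_def defs .
  \<comment> \<open>The \<open>z\<close> pairs of \<open>c\<close> with \<open>y\<close> are still
    unsettled, so the potential is at least \<open>400 * z\<close>. With \<open>z > 0\<close> the
    supply then contains \<open>200 * z + 120\<close> in spite of the deficit of 40.\<close>
  have "undone part (dn(c * n + y := Suc 0)) + z = undone part dn"
    using undone_upd[of c m y dn part C] h i(1) C_def card unfolding parts_inv_def by blast
  then have "400 * z \<le> potential (undone part dn) m c y"
    unfolding potential_def by simp
  then obtain N' where N': "N = N' + 200 * z + 120"
      "potential (undone part dn) m c y + B \<le> N' + 200 * z + 160"
    using pot cs(3) le_Suc_ex[of "200 * z + 120" N] by auto
  have s0: "vars s ''m'' = m" "arrays s ''part'' = part" "arrays s ''size'' = sz" "sz c = z" "arrays s ''done'' = dn" "rep_inv rep"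
      "y < n" "Suc y \<le> n" "z \<le> n" "c < m" "m \<le> n" "rep a \<le> n"
    and cs0: "row n mem c z = cs" "set cs = C" "C \<subseteq> {..<n}" "y \<notin> C"
    using i(2) h cs mn ra yC unfolding defs z_def cs_def by simp_all
  note tail' = tail[unfolded block.simps]
  show ?thesis
  proof (cases "rep a = 0")
    case True
    show ?thesis
      unfolding process_def N'
      using f s u(1) c_def[symmetric] y_def[symmetric] mem_def[symmetric] rep_def[symmetric] a_def[symmetric] True
      apply (simp del: One_nat_def)
      apply (rule wpt_use)
       apply (rule wpt_separate[where c = c and m = m and y = y and L = L and rep = rep and z = z
          and mem = mem and part = part and cs = cs and B = "N' + 50"])
                          apply (simp_all add: s0 cs0 L_def)[23]
      subgoal for t M
        using N'(2)
        apply (elim conjE)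
        apply (rule tail')
                       apply (simp_all add: separate_def keep_def s0 cs0 del: One_nat_def)
        done
      done
  next
    case False
    show ?thesis
      unfolding process_def N'
      using f s u(1) c_def[symmetric] y_def[symmetric] mem_def[symmetric] rep_def[symmetric] a_def[symmetric] False
      apply (simp del: One_nat_def)
      apply (rule wpt_use)
       apply (rule wpt_separate[where c = c and m = m and y = y and L = L and rep = rep and z = z
          and mem = mem and part = part and cs = cs and B = "N' + 50"])
                          apply (simp_all add: s0 cs0 L_def)[23]
      subgoal for t M
        using N'(2)
        apply (elim conjE)
        apply (rule tail')
                       apply (simp_all add: separate_def keep_def s0 cs0 del: One_nat_def)
        done
      done
  qed
qed

lemma refiningD:
  assumes "refining t"
  shows "vars t ''n'' = n" "vars t ''c'' \<le> vars t ''m''" "vars t ''m'' \<le> n" "vars t ''y'' \<le> n"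
    "u < n \<Longrightarrow> arrays t ''part'' u < vars t ''m''"
    "vars t ''c'' < vars t ''m'' \<Longrightarrow> x < n \<Longrightarrow> arrays t ''done'' (vars t ''c'' * n + x) \<le> 1"
proof -
  note i = assms[unfolded refining_def refine_inv_def]
  have "parts_inv (arrays t ''part'') (vars t ''m'') (arrays t ''mem'') (arrays t ''size'')"
    using i by blast
  then show "vars t ''m'' \<le> n" by (rule parts_le)
  show "vars t ''n'' = n" using i by blast
  show "vars t ''c'' \<le> vars t ''m''" "vars t ''y'' \<le> n"
    using i unfolding scan_inv_def by simp_all
  show "u < n \<Longrightarrow> arrays t ''part'' u < vars t ''m''"
    using i unfolding parts_inv_def by simp
  show "vars t ''c'' < vars t ''m'' \<Longrightarrow> x < n \<Longrightarrow> arrays t ''done'' (vars t ''c'' * n + x) \<le> 1"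
    using i unfolding done_inv_def by simp
qed

lemma wpt_refine:
  assumes "refining s" "credits s + B + 40 \<le> N"
  shows "wpt w refine (\<lambda>t M. refining t \<and> vars t ''c'' = vars t ''m'' \<and> B \<le> M) s N"
  unfolding refine_def
proof (rule wpt_While[where I = "\<lambda>t M. refining t \<and> credits t + B + 40 \<le> M"], goal_cases)
  case 1
  then show ?case using assms by simp
next
  case (2 t M)
  then have ref: "refining t" and M: "credits t + B + 40 \<le> M" by auto
  note d = refiningD[OF ref]
  let ?c = "vars t ''c''" and ?m = "vars t ''m''" and ?y = "vars t ''y''"
  have inv: "refine_inv (arrays t ''part'') ?m (arrays t ''mem'') (arrays t ''size'')
       (arrays t ''rep'') (arrays t ''done'') ?c ?y"
    and cls: "arrays t ''cls'' = cls"
    using ref unfolding refining_def by auto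
  have f: "?c < 2 ^ w" "?m < 2 ^ w" "?y < 2 ^ w" "Suc ?c < 2 ^ w" "Suc ?y < 2 ^ w" "n < 2 ^ w"
    "?c * n < 2 ^ w" "?c * n + ?y < 2 ^ w"
    using d(2-4) by (simp_all add: fits_small fits_address)
  show ?case
  proof (cases "?c < ?m")
    case False
    then show ?thesis using f d(2) ref M by simp
  next
    case c: True
    obtain M' where M': "M = M' + 40" using M le_Suc_ex[of 40 M] by auto
    show ?thesis
    proof (cases "?y < n")
      case False
      then have y: "?y = n" using d(4) by simp
      have *: "refine_inv (arrays t ''part'') ?m (arrays t ''mem'') (arrays t ''size'')
         (arrays t ''rep'') (arrays t ''done'') (Suc ?c) 0"
        using inv c unfolding y by (rule step_next)
      \<comment> \<open>Moving to the next part releases \<open>60 * n + 60\<close>, of which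
        \<open>60 * n\<close> go into resetting \<open>y\<close> to 0.\<close>
      have "n - ?c = Suc (n - Suc ?c)" using c d(3) by simp
      then have pot: "potential (undone (arrays t ''part'') (arrays t ''done'')) ?m (Suc ?c) 0 + 60 =
          credits t"
        unfolding credits_def potential_def y by simp
      then show ?thesis
        using c False f d(1) M
        apply (simp del: One_nat_def)
        apply (simp add: refining_def cls *)
        apply (simp add: credits_def)
        apply (intro conjI; linarith)
        done
    next
      case y: True
      have f': "arrays t ''part'' ?y < 2 ^ w" "arrays t ''done'' (?c * n + ?y) < 2 ^ w"
        using d(3) d(5)[OF y] d(6)[OF c y] by (simp_all add: fits_small)
      show ?thesis
      proof (cases "arrays t ''part'' ?y \<noteq> ?c \<and> arrays t ''done'' (?c * n + ?y) = 0")
        case True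
        \<comment> \<open>The loop test and the two conditionals in front of \<open>process\<close>
          cost 4, 4 and 15 steps.\<close>
        have "wpt w process (\<lambda>t M. refining t \<and> credits t + (B + 40) \<le> M) t (M - 23)"
          using ref c y True M by (intro wpt_process) auto
        then have "wpt w process (\<lambda>t M. refining t \<and> credits t + B + 40 \<le> M) t (M - 23)"
          by (simp add: add.assoc)
        then show ?thesis
          using True c y f f' d(1) M
          apply (simp del: One_nat_def)
          apply (intro conjI; linarith)
          done
      next
        case False
        have *: "refine_inv (arrays t ''part'') ?m (arrays t ''mem'') (arrays t ''size'')
           (arrays t ''rep'') (arrays t ''done'') ?c (Suc ?y)"
          using inv c y False by (intro step_skip) auto
        have "n - ?y = Suc (n - Suc ?y)" using y by simp
        then have pot: "potential (undone (arrays t ''part'') (arrays t ''done'')) ?m ?c (Suc ?y) + 60 =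
            credits t"
          unfolding credits_def potential_def by simp
        then show ?thesis
          using False c y f f' d(1) M
          apply (simp del: One_nat_def)
          apply (simp add: refining_def cls *)
          apply (simp add: credits_def)
          apply (intro conjI; linarith)
          done
      qed
    qed
  qed
qed

end

section \<open>From the input to the output\<close>

text \<open>The only use of homogeneity: as the listed sets are the classes of an equivalence, every
  \<open>x \<noteq> u\<close> occurs in the listing at \<open>u\<close>, and it occurs in the set
  that is its own class.\<close>

lemma set_relation_instance:
  assumes xs: "distinct xs" "set xs = X" "length xs = n" and H: "homogeneous X H" and S: "S \<subseteq> X"
    and hs: "length hs = n"
      "\<And>u. u < n \<Longrightarrow> lists_partition xs ((X - {xs ! u}) // rel_at X H (xs ! u)) (hs ! u)"
  shows "\<And>ls. ls \<in> set hs \<Longrightarrow>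
      set (concat ls) \<subseteq> {..<n} \<and> distinct (concat ls) \<and> length ls \<le> n"
    and "umodule_instance X H S xs (set_relation n 0 hs (\<lambda>_. 0)) n"
proof -
  \<comment> \<open>Since no class is empty, there are at most as many classes as listed elements;
    this bounds the class numbers by \<open>n\<close>.\<close>
  have sub: "set (concat ls) \<subseteq> {..<n}" "distinct (concat ls)" "length ls \<le> length (concat ls)"
    "length (concat ls) \<le> n" if ls: "ls \<in> set hs" for ls
  proof -
    obtain u where u: "u < n" "ls = hs ! u" using ls unfolding in_set_conv_nth hs(1) by blast
    then show *: "set (concat ls) \<subseteq> {..<n}" "distinct (concat ls)"
      using hs(2)[OF u(1)] xs(3) unfolding lists_partition_def by auto
    have "[] \<notin> set ls" using hs(2)[OF u(1)] u unfolding lists_partition_def by auto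
    then show "length ls \<le> length (concat ls)"
    proof (induction ls)
      case (Cons l ls)
      then show ?case by (cases l) auto
    qed simp
    show "length (concat ls) \<le> n"
      using card_mono[OF _ *(1)] distinct_card[OF *(2)] by simp
  qed
  show *: "set (concat ls) \<subseteq> {..<n} \<and> distinct (concat ls) \<and> length ls \<le> n" if "ls \<in> set hs" for ls
    using sub[OF that] by linarith
  define cls where "cls = set_relation n 0 hs (\<lambda>_. 0)"
  have cls: "cls (u * n + x) = j" if "u < n" "j < length (hs ! u)" "x \<in> set (hs ! u ! j)" for u j x
    using set_relation_nth[of hs n u j x 0 "\<lambda>_. 0"] * that hs(1) unfolding cls_def by simp
  have inX: "xs ! x \<in> X - {xs ! u}" if "u < n" "x < n" "x \<noteq> u" for u x
    using that xs by (auto simp: nth_eq_iff_index_eq)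
  have in_class: "\<exists>j<length (hs ! u). x \<in> set (hs ! u ! j) \<and>
      (!) xs ` set (hs ! u ! j) = rel_at X H (xs ! u) `` {xs ! x}"
    if u: "u < n" "x < n" "x \<noteq> u" for u x
  proof -
    have "rel_at X H (xs ! u) `` {xs ! x} \<in> (X - {xs ! u}) // rel_at X H (xs ! u)"
      using inX[OF u] by (rule quotientI)
    also have "\<dots> = (\<lambda>l. (!) xs ` set l) ` set (hs ! u)"
      using hs(2)[OF u(1)] unfolding lists_partition_def by simp
    finally obtain l where l: "l \<in> set (hs ! u)" "(!) xs ` set l = rel_at X H (xs ! u) `` {xs ! x}"
      by (metis imageE)
    have "equiv (X - {xs ! u}) (rel_at X H (xs ! u))"
      using H xs(2,3) u(1) unfolding homogeneous_def by auto
    then have "xs ! x \<in> (!) xs ` set l"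
      unfolding l(2) using inX[OF u] by (rule equiv_class_self)
    then obtain x' where "x' \<in> set l" "xs ! x = xs ! x'" by auto
    moreover from this have "x' < n"
      using hs(2)[OF u(1)] l(1) xs(3) unfolding lists_partition_def by auto
    ultimately have "x \<in> set l" using xs u by (simp add: nth_eq_iff_index_eq)
    then show ?thesis using l by (metis in_set_conv_nth)
  qed
  have "umodule_instance X H S xs cls n"
  proof
    show "distinct xs" "set xs = X" "n = length xs" "S \<subseteq> X" using xs S by auto
    show "cls (u * n + x) < n" if "u < n" "x < n" "x \<noteq> u" for u x
      using in_class[OF that] cls[OF that(1)] *[of "hs ! u"] that hs(1) by fastforce
    show "cls (u * n + x) = cls (u * n + x') \<longleftrightarrow> H (xs ! u) (xs ! x) (xs ! x')"
      if u: "u < n" "x < n" "x' < n" "x \<noteq> u" "x' \<noteq> u" for u x x'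
    proof -
      obtain j where j: "j < length (hs ! u)" "x \<in> set (hs ! u ! j)"
        "(!) xs ` set (hs ! u ! j) = rel_at X H (xs ! u) `` {xs ! x}"
        using in_class[of u x] u by blast
      obtain j' where j': "j' < length (hs ! u)" "x' \<in> set (hs ! u ! j')"
        using in_class[of u x'] u by blast
      have "H (xs ! u) (xs ! x) (xs ! x') \<longleftrightarrow> xs ! x' \<in> (!) xs ` set (hs ! u ! j)"
        unfolding j(3) using inX[of u x] inX[of u x'] u by (simp add: rel_at_def)
      also have "\<dots> \<longleftrightarrow> x' \<in> set (hs ! u ! j)"
      proof
        assume "xs ! x' \<in> (!) xs ` set (hs ! u ! j)"
        then obtain y where y: "y \<in> set (hs ! u ! j)" "xs ! x' = xs ! y" by auto
        moreover have "y < n"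
          using *[of "hs ! u"] u(1) hs(1) y(1) j(1) by (auto dest: nth_mem)
        ultimately show "x' \<in> set (hs ! u ! j)"
          using xs u by (simp add: nth_eq_iff_index_eq)
      qed simp
      also have "\<dots> \<longleftrightarrow> j' = j"
        using cls[OF u(1) j(1), of x'] cls[OF u(1) j'] j'(2) by auto
      also have "\<dots> \<longleftrightarrow> cls (u * n + x) = cls (u * n + x')"
        using cls[OF u(1) j(1,2)] cls[OF u(1) j'] by auto
      finally show ?thesis by simp
    qed
  qed
  then show "umodule_instance X H S xs (set_relation n 0 hs (\<lambda>_. 0)) n"
    unfolding cls_def .
qed

lemma umodule_in_side_subset_MU:
  assumes "finite X" "umodule_in_side X H S V" "V \<noteq> {}"
  shows "\<exists>U\<in>MU X H S. V \<subseteq> U"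
proof -
  let ?A = "{U. umodule_in_side X H S U}"
  have "finite ?A"
    by (rule finite_subset[of _ "Pow X"])
      (use assms(1) in \<open>auto simp: umodule_in_side_def umodule_def\<close>)
  then obtain U where "umodule_in_side X H S U" "V \<subseteq> U"
    "\<forall>W. umodule_in_side X H S W \<longrightarrow> U \<subseteq> W \<longrightarrow> U = W"
    using finite_has_maximal2[of ?A V] assms(2) by auto
  then show ?thesis using assms(3) unfolding MU_def by blast
qed

context umodule_instance
begin

lemma partition_on_part_sets:
  assumes "parts_inv part m mem sz"
  shows "partition_on X (part_sets part m)"
proof (rule partition_onI)
  show "{} \<notin> part_sets part m"
  proof
    assume "{} \<in> part_sets part m"
    then obtain c where c: "c < m" "{u. u < n \<and> part u = c} = {}"
      unfolding part_sets_def by auto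
    have "row n mem c (sz c) ! 0 \<in> set (row n mem c (sz c))"
      using assms c(1) unfolding parts_inv_def by (intro nth_mem) simp
    also have "set (row n mem c (sz c)) = {u. u < n \<and> part u = c}"
      using assms c(1) unfolding parts_inv_def by simp
    also note c(2)
    finally show False by simp
  qed
  show "\<Union> (part_sets part m) = X"
  proof (intro equalityI subsetI)
    fix x assume "x \<in> X"
    then obtain u where "u < n" "x = xs ! u"
      using set_xs n_def by (metis in_set_conv_nth)
    moreover from this have "part u < m" using assms unfolding parts_inv_def by blast
    ultimately show "x \<in> \<Union> (part_sets part m)" unfolding part_sets_def by blast
  qed (auto simp: part_sets_def)
  show "disjnt p q" if "p \<in> part_sets part m" "q \<in> part_sets part m" "p \<noteq> q" for p q
    using that distinct_xs n_def unfolding part_sets_def disjnt_def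
    by (auto simp: nth_eq_iff_index_eq)
qed

text \<open>That \<open>MU\<close> covers \<open>X\<close> by disjoint sets is read off from a
  finished state. It is coarsest because each part of a competing partition is a nonempty umodule
  within one side and so lies in a maximal one.\<close>

lemma coarsest_MU:
  assumes "refine_inv part m mem sz rep dn m y"
  shows "coarsest_umodule_partition X H S (MU X H S)"
proof -
  have "partition_on X (MU X H S)"
    using partition_on_part_sets[of part m mem sz] assms part_sets_eq_MU[OF assms]
    unfolding refine_inv_def by simp
  moreover have "umodule_in_side X H S V"
    if "umodule_partition X H S Q" "V \<in> Q" for Q V
    using that unfolding umodule_partition_def thinner_def umodule_in_side_def by blast
  moreover have "V \<noteq> {}" if "umodule_partition X H S Q" "V \<in> Q" for Q V
    using that unfolding umodule_partition_def partition_on_def by auto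
  moreover have "finite X" using set_xs by auto
  ultimately show ?thesis
    unfolding coarsest_umodule_partition_def
    using umodule_in_side_subset_MU[of X H S]
    by (auto simp: umodule_partition_def thinner_def MU_def umodule_in_side_def)
qed

lemma lists_partition_rows:
  assumes "parts_inv part m mem sz"
  shows "lists_partition xs (part_sets part m) (map (\<lambda>c. row n mem c (sz c)) [0..<m])"
proof -
  let ?r = "\<lambda>c. row n mem c (sz c)"
  have r: "distinct (?r c)" "set (?r c) = {u. u < n \<and> part u = c}" "0 < sz c" if "c < m" for c
    using assms that unfolding parts_inv_def by blast+
  have "distinct (concat (map ?r [0..<k])) \<and> set (concat (map ?r [0..<k])) = {u. u < n \<and> part u < k}"
    if "k \<le> m" for k
    using that by (induction k) (auto simp: r less_Suc_eq)
  from this[of m] have "distinct (concat (map ?r [0..<m]))"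
    "set (concat (map ?r [0..<m])) \<subseteq> {..<length xs}"
    using n_def by auto
  moreover have "[] \<notin> set (map ?r [0..<m])"
  proof
    assume "[] \<in> set (map ?r [0..<m])"
    then obtain c where "c < m" "?r c = []" by auto
    then show False using r(3)[of c] length_row[of n mem c "sz c"] by simp
  qed
  moreover have "(\<lambda>l. (!) xs ` set l) ` set (map ?r [0..<m]) = part_sets part m"
    unfolding part_sets_def by (force simp: r(2))
  ultimately show ?thesis unfolding lists_partition_def by simp
qed

text \<open>With all slots and flags 0, coherence only says that a umodule within one side stays in
  one part, and no comparison is claimed. What needs work is that every part number below
  \<open>m\<close> is taken, also when \<open>S\<close> is empty or all of \<open>X\<close>.\<close>

lemma refine_inv_init:
  assumes l: "distinct l" "set l = {u. u < n \<and> xs ! u \<in> S}"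
    and g: "\<And>u. u < n \<Longrightarrow> g u = (if u \<in> set l \<or> l = [] then 0 else 1)"
    and m: "m = (if l = [] then 0 else 1) + (if length l < n then 1 else (0::nat))"
    and part: "\<And>u. u < n \<Longrightarrow> part u = g u"
    and sz: "\<And>c. c \<le> 1 \<Longrightarrow> sz c = length (filter (\<lambda>x. g x = c) [0..<n])"
    and mem: "\<And>c. c \<le> 1 \<Longrightarrow> row n mem c (sz c) = filter (\<lambda>x. g x = c) [0..<n]"
  shows "refine_inv part m mem sz (\<lambda>_. 0) (\<lambda>_. 0) 0 0"
proof -
  have len: "length l \<le> n" "length l = n \<Longrightarrow> set l = {..<n}"
    using l distinct_card[OF l(1)] card_mono[of "{..<n}" "set l"]
      card_subset_eq[of "{..<n}" "set l"] by auto
  have ne: "\<exists>u<n. g u = c" if c: "c < m" for c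
  proof (cases "l = []")
    case True
    then have "n > 0" "c = 0" using c m by (auto split: if_splits)
    then show ?thesis using g[of 0] True by auto
  next
    case False
    show ?thesis
    proof (cases "c = 0")
      case True
      obtain u where "u \<in> set l" using False by (cases l) auto
      then show ?thesis using l(2) g[of u] True by auto
    next
      case c0: False
      then have "length l < n" "c = 1" using c m False by (auto split: if_splits)
      have "set l \<noteq> {..<n}"
      proof
        assume "set l = {..<n}"
        with distinct_card[OF l(1)] \<open>length l < n\<close> show False by simp
      qed
      moreover have "set l \<subseteq> {..<n}" using l(2) by auto
      ultimately obtain u where "u < n" "u \<notin> set l" by blast
      then show ?thesis using g[of u] False \<open>c = 1\<close> by auto
    qed
  qed
  have lt: "g u < m" if "u < n" for u
    using g[OF that] that len m by (auto split: if_splits)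
  have c1: "c \<le> 1" if "c < m" for c
    using m that by (auto split: if_splits)
  have "parts_inv part m mem sz"
    unfolding parts_inv_def
  proof (intro conjI allI impI)
    show "part u < m" if "u < n" for u using lt part that by simp
    fix c assume c: "c < m"
    note mem = mem[OF c1[OF c]] and sz = sz[OF c1[OF c]]
    show "distinct (row n mem c (sz c))" by (simp add: mem)
    show "set (row n mem c (sz c)) = {u. u < n \<and> part u = c}" using part by (auto simp: mem)
    show "0 < sz c" using ne[OF c] by (auto simp: sz filter_empty_conv)
  next
    fix u u' assume u: "u < n" "u' < n" and "part u = part u'"
    then have "g u = g u'" by (simp add: part)
    then have "u \<in> set l \<longleftrightarrow> u' \<in> set l"
      unfolding g[OF u(1)] g[OF u(2)] by (cases "l = []") (simp_all split: if_splits)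
    then show "xs ! u \<in> S \<longleftrightarrow> xs ! u' \<in> S"
      using u unfolding l(2) by simp
  qed
  moreover have "part u = part u'"
    if V: "umodule_in_side X H S V" and u: "u < n" "u' < n" "xs ! u \<in> V" "xs ! u' \<in> V" for V u u'
  proof -
    have "xs ! u \<in> S \<longleftrightarrow> xs ! u' \<in> S" using V u unfolding umodule_in_side_def by blast
    then have "u \<in> set l \<longleftrightarrow> u' \<in> set l" unfolding l(2) using u by simp
    then show ?thesis by (simp add: part g u)
  qed
  then have "coherent part (\<lambda>_. 0)" unfolding coherent_def by blast
  ultimately show ?thesis
    by (simp add: refine_inv_def rep_inv_def done_inv_def scan_inv_def)
qed

end

lemma length_enc_sets: "length (concat (map enc_set ls)) = length ls + length (concat ls)"
  by (induction ls) (simp_all add: enc_set_def)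

lemma has_output_stored: "has_output t ws \<longleftrightarrow> stored (arrays t ''out'') 0 ws"
  by (simp add: has_output_def stored_def)

context refinement
begin

lemma wpt_output:
  assumes ref: "refining s" and c: "vars s ''c'' = vars s ''m''" and N: "300 * n + 100 \<le> N"
  shows "wpt w (block [Write ''out'' (Const 0) (Var ''m''),
     Assign ''t'' (Const 1), Assign ''c'' (Const 0), write_parts])
     (\<lambda>t M. represents_output xs (MU X H S) t) s N"
proof -
  define m where "m = vars s ''m''"
  define mem where "mem = arrays s ''mem''"
  define sz where "sz = arrays s ''size''"
  define part where "part = arrays s ''part''"
  have inv: "refine_inv part m mem sz (arrays s ''rep'') (arrays s ''done'') m (vars s ''y'')"
    using ref c unfolding refining_def m_def mem_def sz_def part_def by simp
  then have parts: "parts_inv part m mem sz" unfolding refine_inv_def by blast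
  have mn: "m \<le> n" by (rule parts_le[OF parts])
  define ls where "ls = map (\<lambda>c. row n mem c (sz c)) [0..<m]"
  have lp: "lists_partition xs (MU X H S) ls"
    using lists_partition_rows[OF parts] unfolding part_sets_eq_MU[OF inv] ls_def .
  have "length (concat ls) \<le> n"
    using lp card_mono[of "{..<n}" "set (concat ls)"] distinct_card[of "concat ls"]
    unfolding lists_partition_def n_def by simp
  then have len: "length (concat (map enc_set ls)) \<le> 2 * n"
    using mn by (simp add: length_enc_sets) (simp add: ls_def)
  have row: "set (row n mem k (sz k)) \<subseteq> {..<n}" "sz k \<le> n" if "k < m" for k
    using size_le[OF parts that] parts that unfolding parts_inv_def by auto
  have out: "represents_output xs (MU X H S) t"
    if "arrays t ''out'' = store 1 (concat (map enc_set ls)) ((arrays s ''out'')(0 := m))" for t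
    unfolding represents_output_def has_output_stored
    using that lp stored_store[of 1 "concat (map enc_set ls)" "(arrays s ''out'')(0 := m)"]
    by (intro exI[of _ ls]) (simp add: enc_partition_def store_less ls_def)
  have f: "m < 2 ^ w" "n < 2 ^ w" "(1::nat) < 2 ^ w" "1 + length (concat (map enc_set ls)) < 2 ^ w"
    using mn len by (simp_all add: fits_small)
  have s: "vars s ''n'' = n" using ref by (rule refiningD)
  obtain N' where N': "N = N' + 100 * length (concat (map enc_set ls)) + 100"
    using N len le_Suc_ex[of "100 * length (concat (map enc_set ls)) + 100" N] by auto
  show ?thesis
    unfolding N'
    using f(1,3) s m_def[symmetric]
    apply (simp del: One_nat_def)
    apply (rule wpt_use)
     apply (rule wpt_write_parts[where ls = ls and B = 1])
          apply (simp add: ls_def)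
         apply (simp add: ls_def)
        apply (simp add: mn)
       apply (simp add: ls_def stored_row row mem_def[symmetric] sz_def[symmetric])
    using f(4)
      apply simp
     apply simp
    apply (simp add: out del: One_nat_def)
    done
qed

text \<open>The postcondition carries the mathematical claim about \<open>MU\<close> along with the
  output, because that claim is derived from the final state of \<open>refine\<close>, which is at
  hand here.\<close>

lemma wpt_refinement:
  assumes s: "vars s ''n'' = n" "vars s ''r'' = length l" "arrays s ''cls'' = cls"
      "arrays s ''rep'' = (\<lambda>_. 0)" "arrays s ''done'' = (\<lambda>_. 0)"
    and l: "distinct l" "set l = {u. u < n \<and> xs ! u \<in> S}"
    and side: "arrays s ''side'' = set_class 0 1 l (\<lambda>_. 0)"
    and part: "\<forall>x<n. arrays s ''part'' x =
      (1 - arrays s ''side'' x) * (1 - (1 - vars s ''r''))"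
    and size: "\<forall>c\<le>1. arrays s ''size'' c = length
        (filter (\<lambda>x. (1 - arrays s ''side'' x) * (1 - (1 - vars s ''r'')) = c) [0..<n]) \<and>
      row n (arrays s ''mem'') c (arrays s ''size'' c) =
        filter (\<lambda>x. (1 - arrays s ''side'' x) * (1 - (1 - vars s ''r'')) = c) [0..<n]"
    and N: "800 * (n * n) + 1000 * n + 500 \<le> N"
  shows "wpt w (block [Assign ''m'' (Plus (positive (Var ''r'')) (positive (Minus (Var ''n'') (Var ''r'')))),
      Assign ''c'' (Const 0), Assign ''y'' (Const 0), refine,
      Write ''out'' (Const 0) (Var ''m''),
      Assign ''t'' (Const 1), Assign ''c'' (Const 0), write_parts])
     (\<lambda>t M. represents_output xs (MU X H S) t \<and>
       coarsest_umodule_partition X H S (MU X H S)) s N"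
proof -
  define g where "g x = (1 - arrays s ''side'' x) * (1 - (1 - vars s ''r''))" for x
  define m where "m = (if l = [] then 0 else 1) + (if length l < n then 1 else (0::nat))"
  have inv: "refine_inv (arrays s ''part'') m (arrays s ''mem'') (arrays s ''size'')
      (\<lambda>_. 0) (\<lambda>_. 0) 0 0"
  proof (rule refine_inv_init[where g = g, OF l])
    show "g u = (if u \<in> set l \<or> l = [] then 0 else 1)" if "u < n" for u
      unfolding g_def side s(2) by (cases l) (auto simp: set_class_apply)
    show "arrays s ''part'' u = g u" if "u < n" for u
      using part that unfolding g_def by blast
    show "arrays s ''size'' c = length (filter (\<lambda>x. g x = c) [0..<n])"
      "row n (arrays s ''mem'') c (arrays s ''size'' c) = filter (\<lambda>x. g x = c) [0..<n]"
      if "c \<le> 1" for c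
      using size that unfolding g_def by blast+
  qed (simp add: m_def)
  have len: "length l \<le> n"
    using distinct_card[OF l(1)] card_mono[of "{..<n}" "set l"] l(2) by auto
  have m: "1 - (1 - length l) + (1 - (1 - (n - length l))) = m"
    unfolding m_def by (cases l) auto
  have "m \<le> 2" unfolding m_def by simp
  have f: "n < 2 ^ w" "length l < 2 ^ w" "n - length l < 2 ^ w" "m < 2 ^ w"
    using len \<open>m \<le> 2\<close> by (auto intro!: fits_small)
  have tail: "wpt w (block [Write ''out'' (Const 0) (Var ''m''),
       Assign ''t'' (Const 1), Assign ''c'' (Const 0), write_parts])
     (\<lambda>t M. represents_output xs (MU X H S) t \<and>
       coarsest_umodule_partition X H S (MU X H S)) t M"
    if t: "refining t" "vars t ''c'' = vars t ''m''" "300 * n + 100 \<le> M" for t M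
  proof -
    have "coarsest_umodule_partition X H S (MU X H S)"
    proof (rule coarsest_MU)
      show "refine_inv (arrays t ''part'') (vars t ''m'') (arrays t ''mem'') (arrays t ''size'')
          (arrays t ''rep'') (arrays t ''done'') (vars t ''m'') (vars t ''y'')"
        using t(1,2) by (simp add: refining_def)
    qed
    with wpt_output[OF t] show ?thesis by simp
  qed
  \<comment> \<open>At most \<open>n * n\<close> pairs are unsettled. The quadratic terms add up to
    400 + 300 + 60, the linear ones to 400 + 60 + 60.\<close>
  have "potential (undone p d) m 0 0 \<le> 760 * (n * n) + 520 * n" for p d
    using undone_le[of p d] unfolding potential_def
    by (simp add: algebra_simps)
  then have pot: "potential (undone (arrays s ''part'') (\<lambda>_. 0)) m 0 0 \<le> 760 * (n * n) + 520 * n" .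
  obtain N' where N': "N = N' + 760 * (n * n) + 520 * n + 100" "300 * n + 400 \<le> N'"
    using N le_Suc_ex[of "760 * (n * n) + 520 * n + 100" N] by auto
  note tail' = tail[unfolded block.simps]
  have f1: "(1::nat) < 2 ^ w" "1 - k < 2 ^ w" for k :: nat
    by simp_all
  show ?thesis
    unfolding N'
    using f f1 s(1-2) m
    apply (simp del: One_nat_def)
    apply (rule wpt_use)
     apply (rule wpt_refine[where B = N'])
      apply (simp add: refining_def s inv)
    using pot
     apply (simp add: credits_def s)
    subgoal for t M
      using N'(2)
      apply (elim conjE)
      apply (rule tail')
        apply simp_all
      done
    done
qed

lemma wpt_compute_MU:
  assumes hs: "length hs = n"
      "\<And>ls. ls \<in> set hs \<Longrightarrow>
        set (concat ls) \<subseteq> {..<n} \<and> distinct (concat ls) \<and> length ls \<le> n"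
      "cls = set_relation n 0 hs (\<lambda>_. 0)"
    and l: "lists_set xs S l"
    and N: "2000 * (n * n) + 2000 * n + 2000 \<le> N"
  shows "wpt w compute_MU (\<lambda>t M. represents_output xs (MU X H S) t \<and>
     coarsest_umodule_partition X H S (MU X H S)) (init_state (enc_input hs l)) N"
proof -
  define s where "s = init_state (enc_input hs l)"
  define E where "E = concat (map enc_partition hs)"
  have l': "distinct l" "set l \<subseteq> {..<n}" "(!) xs ` set l = S"
    using l n_def unfolding lists_set_def by auto
  have set_l: "set l = {u. u < n \<and> xs ! u \<in> S}"
  proof (intro equalityI subsetI)
    fix u assume "u \<in> {u. u < n \<and> xs ! u \<in> S}"
    then obtain v where v: "v \<in> set l" "xs ! u = xs ! v" "u < n" unfolding l'(3)[symmetric] by auto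
    then have "u = v" using l'(2) distinct_xs n_def by (auto simp: nth_eq_iff_index_eq)
    then show "u \<in> set l" using v by simp
  qed (use l' in auto)
  have len: "length l \<le> n"
    using distinct_card[OF l'(1)] card_mono[OF _ l'(2)] by simp
  \<comment> \<open>One word for the number of classes, at most \<open>n\<close> for their lengths
    and at most \<open>n\<close> for their members.\<close>
  have "length (enc_partition ls) \<le> 2 * n + 1" if "ls \<in> set hs" for ls
    using hs(2)[OF that] card_mono[of "{..<n}" "set (concat ls)"] distinct_card[of "concat ls"]
    by (simp add: enc_partition_def length_enc_sets)
  then have "length (concat (map enc_partition hs')) \<le> length hs' * (2 * n + 1)"
    if "set hs' \<subseteq> set hs" for hs'
    using that by (induction hs') fastforce+
  then have E: "length E \<le> 2 * (n * n) + n"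
    using hs(1) unfolding E_def by (fastforce simp: algebra_simps)
  have fit: "k < 2 ^ w" if "k \<le> 2 * (n * n) + 8 * n + 7" for k
    using big that by (simp add: algebra_simps)
  have v: "vars s x = 0" for x unfolding s_def init_state_def by simp
  have arr: "arrays s a = (\<lambda>_. 0)" if "a \<noteq> ''in''" for a
    using that unfolding s_def init_state_def by auto
  have "stored (arrays s ''in'') 0 (enc_input hs l)"
    unfolding s_def init_state_def stored_def by simp
  then have st: "arrays s ''in'' 0 = n" "stored (arrays s ''in'') (Suc 0) E"
    "arrays s ''in'' (Suc (length E)) = length l" "stored (arrays s ''in'') (Suc (Suc (length E))) l"
    unfolding enc_input_def enc_set_def E_def[symmetric] by (simp_all add: hs(1))
  have f: "n < 2 ^ w" "(1::nat) < 2 ^ w" "length l < 2 ^ w" "Suc (length E) < 2 ^ w"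
    "Suc (Suc (length E)) < 2 ^ w" "Suc (length E) + length l < 2 ^ w"
    "Suc (Suc (length E)) + length l < 2 ^ w"
    using len E by (simp_all add: fit)
  obtain N' where N': "N = N' + 140 * length E + 40 * length l + 100 * n + 200"
      "800 * (n * n) + 1000 * n + 500 \<le> N'"
    using N E len le_Suc_ex[of "140 * length E + 40 * length l + 100 * n + 200" N] by auto
  note refinement' = wpt_refinement[unfolded block.simps One_nat_def]
  show ?thesis
    unfolding s_def[symmetric] compute_MU_def N'
    using f v st
    apply (simp del: One_nat_def)
    apply (rule wpt_use)
     apply (rule wpt_parse_relation[where hs = hs and B = "N' + 40 * length l + 100 * n + 150",
          folded E_def])
         apply (simp_all add: hs(1) E_def[symmetric])[4]
    subgoal for ls
      using hs(2)[of ls] by simp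
     apply simp
    apply (simp add: parse_relation_def parse_partition_def parse_class_def arr hs(3)[symmetric])
    apply (elim conjE)
    apply (intro conjI; (linarith)?)
    apply (rule wpt_use)
     apply (rule wpt_parse_subset[where l = l and B = "N' + 100 * n + 80"])
          apply (use len l'(2) in simp_all)[6]
    apply (simp add: parse_subset_def arr)
    apply (elim conjE)
    apply (intro conjI; (linarith)?)
    apply (rule wpt_use)
     apply (rule wpt_init_parts[where B = N'])
           apply (use len in \<open>simp_all add: set_class_apply arr\<close>)[7]
    apply (elim conjE)
    apply (rule refinement'[where l = l])
               apply (use l'(1) set_l N'(2) in \<open>simp_all add: init_parts_def arr\<close>)
    subgoal premises q
      using q(21) by metis
    done
qed

end

lemma machine_log:
  "machine (nat \<lceil>log 2 (2 * (real n + 2) ^ 2)\<rceil>) n"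
proof
  let ?b = "2 * (real n + 2) ^ 2"
  have "(real n + 2) ^ 2 \<ge> 1" by (rule one_le_power) simp
  then have b: "?b \<ge> 1" by linarith
  then have "log 2 ?b \<ge> 0" by simp
  have "real (2 * (n + 2) * (n + 2)) = ?b"
    by (simp add: power2_eq_square algebra_simps)
  also have "\<dots> = 2 powr (log 2 ?b)" using b by simp
  also have "\<dots> \<le> 2 powr (real (nat \<lceil>log 2 ?b\<rceil>))"
    by (intro powr_mono) linarith+
  also have "\<dots> = real (2 ^ nat \<lceil>log 2 ?b\<rceil>)" by (simp add: powr_realpow)
  finally show "2 * (n + 2) * (n + 2) \<le> 2 ^ nat \<lceil>log 2 ?b\<rceil>"
    by (simp only: of_nat_le_iff)
qed

theorem theorem1:
  "\<exists>(p :: com) (T :: nat \<Rightarrow> nat) (W :: nat \<Rightarrow> nat).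
     (\<lambda>n. real (T n)) \<in> O(\<lambda>n. real n ^ 2 * ln (real n)) \<and>
     (\<lambda>n. real (W n)) \<in> O(\<lambda>n. ln (real n)) \<and>
     (\<forall>(X :: 'a set) H S xs ws.
        finite X \<and> homogeneous X H \<and> S \<subseteq> X \<and> represents_input X H S xs ws \<longrightarrow>
          coarsest_umodule_partition X H S (MU X H S) \<and>
          (\<exists>k t. runs (W (card X)) p (init_state ws) k t \<and> k \<le> T (card X) \<and>
                 represents_output xs (MU X H S) t))"
proof -
  define T :: "nat \<Rightarrow> nat" where "T n = 2000 * (n * n) + 2000 * n + 2000" for n
  \<comment> \<open>The least word size that meets the requirement of
    \<open>machine\<close>.\<close>
  define W :: "nat \<Rightarrow> nat" where "W n = nat \<lceil>log 2 (2 * (real n + 2) ^ 2)\<rceil>" for n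
  have T: "(\<lambda>n. real (T n)) \<in> O(\<lambda>n. real n ^ 2 * ln (real n))"
    unfolding T_def by (simp, real_asymp)
  have W: "(\<lambda>n. real (W n)) \<in> O(\<lambda>n. ln (real n))"
  proof -
    have nat_ceiling: "real (nat \<lceil>x\<rceil>) \<le> x + 1" if "x \<ge> 0" for x :: real
      using that of_int_ceiling_le_add_one[of x] by simp
    have "norm (real (W n)) \<le> 1 * norm (log 2 (2 * (real n + 2) ^ 2) + 1)" for n
    proof -
      have "(real n + 2) ^ 2 \<ge> 1" by (rule one_le_power) simp
      then have "2 * (real n + 2) ^ 2 \<ge> 1" by linarith
      then have "log 2 (2 * (real n + 2) ^ 2) \<ge> 0" by simp
      from nat_ceiling[OF this] have "real (W n) \<le> log 2 (2 * (real n + 2) ^ 2) + 1"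
        unfolding W_def .
      then show ?thesis unfolding mult_1 real_norm_def by linarith
    qed
    then have "(\<lambda>n. real (W n)) \<in> O(\<lambda>n. log 2 (2 * (real n + 2) ^ 2) + 1)"
      by (intro bigoI always_eventually allI)
    also have "(\<lambda>n. log 2 (2 * (real n + 2) ^ 2) + 1) \<in> O(\<lambda>n. ln (real n))"
      by real_asymp
    finally show ?thesis .
  qed
  have run: "coarsest_umodule_partition X H S (MU X H S) \<and>
      (\<exists>k t. runs (W (card X)) compute_MU (init_state ws) k t \<and> k \<le> T (card X) \<and>
        represents_output xs (MU X H S) t)"
    if X: "finite X \<and> homogeneous X H \<and> S \<subseteq> X \<and> represents_input X H S xs ws"
    for X :: "'a set" and H S xs ws
  proof -
    obtain hs l where xs: "distinct xs" "set xs = X" and ws: "ws = enc_input hs l"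
      and hs: "length hs = length xs" "\<And>i. i < length xs \<Longrightarrow>
        lists_partition xs ((X - {xs ! i}) // rel_at X H (xs ! i)) (hs ! i)"
      and l: "lists_set xs S l"
      using X unfolding represents_input_def by blast
    have n: "length xs = card X" using xs distinct_card by fastforce
    have H: "homogeneous X H" and S: "S \<subseteq> X" using X by auto
    have parts: "\<And>ls. ls \<in> set hs \<Longrightarrow>
        set (concat ls) \<subseteq> {..<card X} \<and> distinct (concat ls) \<and> length ls \<le> card X"
      and inst: "umodule_instance X H S xs (set_relation (card X) 0 hs (\<lambda>_. 0)) (card X)"
      by (rule set_relation_instance[OF xs n H S hs[unfolded n]]; assumption)+
    interpret refinement X H S xs "set_relation (card X) 0 hs (\<lambda>_. 0)" "card X" "W (card X)"
      using inst machine_log[of "card X"] unfolding W_def by (rule refinement.intro)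
    have "wpt (W (card X)) compute_MU (\<lambda>t M. represents_output xs (MU X H S) t \<and>
        coarsest_umodule_partition X H S (MU X H S)) (init_state ws) (T (card X))"
      unfolding ws T_def
      by (rule wpt_compute_MU[OF hs(1)[unfolded n] parts refl l order.refl])
    then show ?thesis unfolding wpt_def by blast
  qed
  show ?thesis
    by (intro exI[of _ compute_MU] exI[of _ T] exI[of _ W] conjI[OF T conjI[OF W]] allI impI run)
qed

end
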